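(* Let $W=W_{A_{n-1}}$ and let $M$ be a $K$-module. The action of $x_i$ on the $\ddot{\mathfrak H}^{\mathfrak c}_W$-module $\mathbb C[y_1,\dots,y_n]\otimes M$ is realized as a Dunkl operator as follows. For any polynomial $f\in\mathbb C[y_1,\dots,y_n]$ and $m\in M$, $$x_i\circ(f\otimes m)=u\sum_{k\ne i}\frac{f-f^{s_{ki}}}{y_i-y_k}\otimes(1+c_kc_i)s_{ki}m .$$
   Context: Ground field $\mathbb C$, $u\in\mathbb C$. $W=W_{A_{n-1}}=S_n$, $s_{ij}$ the transposition of $i,j$. $\mathcal C_n$ is generated by $c_1,\dots,c_n$ with $c_i^2=1$, $c_ic_j=-c_jc_i$ ($i\ne j$); $S_n$ permutes the $c_i$. $K=\mathcal C_n\rtimes\mathbb CW$. The rational double affine Hecke-Clifford algebra $\ddot{\mathfrak H}^{\mathfrak c}_W$ of type $A_{n-1}$ is generated by $x_i,y_i,c_i$ ($1\le i\le n$) and $W$, subject to the relations of $K$ and: $x_ix_j=x_jx_i$, $y_iy_j=y_jy_i$, $y_ic_j=c_jy_i$ (all $i,j$); $x_ic_i=-c_ix_i$, $x_ic_j=c_jx_i$ ($i\ne j$); $wx_iw^{-1}=x_{w(i)}$, $wy_iw^{-1}=y_{w(i)}$ ($w\in W$); $[y_j,x_i]=u(1+c_jc_i)s_{ji}$ ($i\ne j$); $[y_i,x_i]=-u\sum_{k\ne i}(1+c_kc_i)s_{ki}$. It has the triangular decomposition $\mathbb C[x_1,\dots,x_n]\otimes K\otimes\mathbb C[y_1,\dots,y_n]$.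 Let $\mathfrak H_x$ be the subalgebra generated by $K$ and $x_1,\dots,x_n$. A $K$-module $M$ is extended to an $\mathfrak H_x$-module by letting all $x_i$ act by $0$, and $M_x=\mathrm{Ind}_{\mathfrak H_x}^{\ddot{\mathfrak H}^{\mathfrak c}_W}M$ is identified as a vector space with $\mathbb C[y_1,\dots,y_n]\otimes M$; this is the module structure in question ($\circ$ denotes the action; $y_i$ acts by left multiplication). $f^\sigma$ denotes the action of $\sigma\in W$ on a polynomial $f$. *)

theory Defs
  imports
    Complex_Main
    "HOL-Library.Poly_Mapping"
    "HOL-Combinatorics.Perm"
    "HOL-Algebra.QuotRing"
    "HOL-Algebra.Generated_Rings"
    "HOL-Algebra.Free_Abelian_Groups"
begin

text \<open>
  The index set \<open>{1,\<dots>,n}\<close> is an arbitrary finite type \<open>'n\<close>, and \<open>W = S_n\<close> is the type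
  \<open>'n perm\<close>; its product is composition of functions.
\<close>

section \<open>Free associative algebras\<close>

text \<open>
  \<open>'g free_alg\<close> is the monoid algebra over \<open>\<complex>\<close> of the free monoid \<open>'g word\<close>.  The monoid is
  written additively because the convolution product on \<^typ>\<open>'a \<Rightarrow>\<^sub>0 'b\<close> requires this.
\<close>

datatype 'g word = Word (letters: "'g list")

instantiation word :: (type) monoid_add
begin
definition zero_word :: "'a word" where "zero_word = Word []"
definition plus_word :: "'a word \<Rightarrow> 'a word \<Rightarrow> 'a word"
  where "plus_word v w = Word (letters v @ letters w)"
instance by standard (auto simp: zero_word_def plus_word_def)
end

type_synonym 'g free_alg = "'g word \<Rightarrow>\<^sub>0 complex"

definition free_ring :: "'g free_alg ring"
  where "free_ring = \<lparr>carrier = UNIV, monoid.mult = (*), monoid.one = 1, ring.zero = 0, ring.add = (+)\<rparr>"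

section \<open>The rational double affine Hecke-Clifford algebra of type A\<close>

datatype 'n gen = GX 'n | GY 'n | GC 'n | GW "'n perm"

definition sc :: "complex \<Rightarrow> 'n gen free_alg" where "sc a = Poly_Mapping.single 0 a"
definition gx :: "'n \<Rightarrow> 'n gen free_alg" where "gx i = Poly_Mapping.single (Word [GX i]) 1"
definition gy :: "'n \<Rightarrow> 'n gen free_alg" where "gy i = Poly_Mapping.single (Word [GY i]) 1"
definition gc :: "'n \<Rightarrow> 'n gen free_alg" where "gc i = Poly_Mapping.single (Word [GC i]) 1"
definition gw :: "'n perm \<Rightarrow> 'n gen free_alg" where "gw \<sigma> = Poly_Mapping.single (Word [GW \<sigma>]) 1"
definition gs :: "'n \<Rightarrow> 'n \<Rightarrow> 'n gen free_alg" where "gs i j = gw (Perm.swap i j)"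

definition K_relators :: "'n gen free_alg set" where
  "K_relators =
     {gw 1 - 1}
   \<union> {gw \<sigma> * gw \<tau> - gw (\<sigma> * \<tau>) | \<sigma> \<tau>. True}
   \<union> {gc i * gc i - 1 | i. True}
   \<union> {gc i * gc j + gc j * gc i | i j. i \<noteq> j}
   \<union> {gw \<sigma> * gc i * gw (inverse \<sigma>) - gc (Perm.apply \<sigma> i) | \<sigma> i. True}"

definition H_relators :: "complex \<Rightarrow> 'n::finite gen free_alg set" where
  "H_relators u = K_relators
   \<union> {gx i * gx j - gx j * gx i | i j. True}
   \<union> {gy i * gy j - gy j * gy i | i j. True}
   \<union> {gy i * gc j - gc j * gy i | i j. True}
   \<union> {gx i * gc i + gc i * gx i | i. True}
   \<union> {gx i * gc j - gc j * gx i | i j. i \<noteq> j}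
   \<union> {gw \<sigma> * gx i * gw (inverse \<sigma>) - gx (Perm.apply \<sigma> i) | \<sigma> i. True}
   \<union> {gw \<sigma> * gy i * gw (inverse \<sigma>) - gy (Perm.apply \<sigma> i) | \<sigma> i. True}
   \<union> {(gy j * gx i - gx i * gy j) - sc u * ((1 + gc j * gc i) * gs j i) | i j. i \<noteq> j}
   \<union> {(gy i * gx i - gx i * gy i)
        + sc u * (\<Sum>k\<in>UNIV - {i}. (1 + gc k * gc i) * gs k i) | i. True}"

definition H_ideal :: "complex \<Rightarrow> 'n::finite gen free_alg set"
  where "H_ideal u = Idl\<^bsub>free_ring\<^esub> (H_relators u)"

definition H_alg :: "complex \<Rightarrow> 'n::finite gen free_alg set ring"
  where "H_alg u = free_ring Quot (H_ideal u)"

definition H_class :: "complex \<Rightarrow> 'n::finite gen free_alg \<Rightarrow> 'n gen free_alg set"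
  where "H_class u a = H_ideal u +>\<^bsub>free_ring\<^esub> a"

definition Hx :: "complex \<Rightarrow> 'n::finite gen free_alg set set" where
  "Hx u = generate_ring (H_alg u)
     (H_class u ` (Set.range sc \<union> Set.range gc \<union> Set.range gw \<union> Set.range gx))"

section \<open>Modules and tensor products\<close>

locale K_module = vector_space scale
  for scale :: "complex \<Rightarrow> 'm::ab_group_add \<Rightarrow> 'm" +
  fixes c :: "'n::finite \<Rightarrow> 'm \<Rightarrow> 'm"
    and w :: "'n perm \<Rightarrow> 'm \<Rightarrow> 'm"
  assumes c_linear: "Vector_Spaces.linear scale scale (c i)"
    and w_linear: "Vector_Spaces.linear scale scale (w \<sigma>)"
    and c_square: "c i (c i m) = m"
    and c_anticommute: "i \<noteq> j \<Longrightarrow> c i (c j m) = - c j (c i m)"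
    and w_one: "w 1 m = m"
    and w_mult: "w (\<sigma> * \<tau>) m = w \<sigma> (w \<tau> m)"
    and w_c: "w \<sigma> (c i (w (inverse \<sigma>) m)) = c (Perm.apply \<sigma> i) m"

text \<open>\<open>M\<close> is the whole type \<open>'m\<close>; \<open>B\<close> is a subring of \<open>R\<close>.\<close>

definition left_module_on ::
  "('r, 'z) ring_scheme \<Rightarrow> 'r set \<Rightarrow> ('r \<Rightarrow> 'm::ab_group_add \<Rightarrow> 'm) \<Rightarrow> bool" where
  "left_module_on R B act \<longleftrightarrow>
     (\<forall>b\<in>B. \<forall>m m'. act b (m + m') = act b m + act b m') \<and>
     (\<forall>b\<in>B. \<forall>b'\<in>B. \<forall>m. act (b \<oplus>\<^bsub>R\<^esub> b') m = act b m + act b' m) \<and>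
     (\<forall>b\<in>B. \<forall>b'\<in>B. \<forall>m. act (b \<otimes>\<^bsub>R\<^esub> b') m = act b (act b' m)) \<and>
     (\<forall>m. act \<one>\<^bsub>R\<^esub> m = m)"

text \<open>
  The extension of a \<open>K\<close>-module to \<open>Hx u\<close> by letting all \<open>x i\<close> act by \<open>0\<close>.  The conditions
  determine the action on \<open>Hx u\<close>; the values outside \<open>Hx u\<close> are irrelevant.
\<close>

definition Hx_action ::
  "complex \<Rightarrow> (complex \<Rightarrow> 'm::ab_group_add \<Rightarrow> 'm) \<Rightarrow> ('n::finite \<Rightarrow> 'm \<Rightarrow> 'm) \<Rightarrow> ('n perm \<Rightarrow> 'm \<Rightarrow> 'm)
     \<Rightarrow> 'n gen free_alg set \<Rightarrow> 'm \<Rightarrow> 'm" where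
  "Hx_action u scale c w = (SOME act. left_module_on (H_alg u) (Hx u) act \<and>
     (\<forall>a m. act (H_class u (sc a)) m = scale a m) \<and>
     (\<forall>i m. act (H_class u (gc i)) m = c i m) \<and>
     (\<forall>\<sigma> m. act (H_class u (gw \<sigma>)) m = w \<sigma> m) \<and>
     (\<forall>i m. act (H_class u (gx i)) m = 0))"

text \<open>
  \<open>R \<otimes>_B M\<close> is the quotient of the free abelian group on the pairs \<open>(r, m)\<close> by the
  biadditivity and balancing relations.  (\<^const>\<open>free_Abelian_group\<close> is a multiplicative record
  whose product is addition.)
\<close>

definition pairs_group :: "('r, 'z) ring_scheme \<Rightarrow> ('r \<times> 'm \<Rightarrow>\<^sub>0 int) monoid"
  where "pairs_group R = free_Abelian_group (carrier R \<times> UNIV)"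

definition tensor_kernel ::
  "('r, 'z) ring_scheme \<Rightarrow> 'r set \<Rightarrow> ('r \<Rightarrow> 'm::ab_group_add \<Rightarrow> 'm) \<Rightarrow> ('r \<times> 'm \<Rightarrow>\<^sub>0 int) set" where
  "tensor_kernel R B act = generate (pairs_group R)
     ({frag_of (r \<oplus>\<^bsub>R\<^esub> r', m) - frag_of (r, m) - frag_of (r', m)
         | r r' m. r \<in> carrier R \<and> r' \<in> carrier R}
    \<union> {frag_of (r, m + m') - frag_of (r, m) - frag_of (r, m') | r m m'. r \<in> carrier R}
    \<union> {frag_of (r \<otimes>\<^bsub>R\<^esub> b, m) - frag_of (r, act b m) | r b m. r \<in> carrier R \<and> b \<in> B})"

definition tensor_class ::
  "('r, 'z) ring_scheme \<Rightarrow> 'r set \<Rightarrow> ('r \<Rightarrow> 'm::ab_group_add \<Rightarrow> 'm)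
     \<Rightarrow> ('r \<times> 'm \<Rightarrow>\<^sub>0 int) \<Rightarrow> ('r \<times> 'm \<Rightarrow>\<^sub>0 int) set" where
  "tensor_class R B act t = tensor_kernel R B act #>\<^bsub>pairs_group R\<^esub> t"

definition tensor_left_action ::
  "('r, 'z) ring_scheme \<Rightarrow> 'r set \<Rightarrow> ('r \<Rightarrow> 'm::ab_group_add \<Rightarrow> 'm)
     \<Rightarrow> 'r \<Rightarrow> ('r \<times> 'm \<Rightarrow>\<^sub>0 int) set \<Rightarrow> ('r \<times> 'm \<Rightarrow>\<^sub>0 int) set" where
  "tensor_left_action R B act r T =
     (\<Union>t\<in>T. tensor_class R B act (frag_extend (\<lambda>(r', m). frag_of (r \<otimes>\<^bsub>R\<^esub> r', m)) t))"

section \<open>Polynomials and the induced module\<close>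

text \<open>
  Monomials in the \<open>y i\<close> are exponent vectors \<open>'n \<Rightarrow>\<^sub>0 nat\<close>.  The vector space
  \<open>\<complex>[y] \<otimes> M\<close> is realized as the space of polynomials with coefficients in \<open>M\<close>.
\<close>

type_synonym 'n ypoly = "('n \<Rightarrow>\<^sub>0 nat) \<Rightarrow>\<^sub>0 complex"
type_synonym ('n, 'm) ypoly_tensor = "('n \<Rightarrow>\<^sub>0 nat) \<Rightarrow>\<^sub>0 'm"

definition yvar :: "'n \<Rightarrow> 'n ypoly"
  where "yvar i = Poly_Mapping.single (Poly_Mapping.single i 1) 1"

text \<open>\<open>f\<close> acted on by \<open>\<sigma>\<close>, i.e. \<open>y i\<close> is replaced by \<open>y (\<sigma> i)\<close>: the coefficient of the
  monomial \<open>\<alpha>\<close> in the result is that of \<open>\<alpha> \<circ> \<sigma>\<close> in \<open>f\<close>.\<close>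

definition perm_poly :: "'n perm \<Rightarrow> 'n ypoly \<Rightarrow> 'n ypoly"
  where "perm_poly \<sigma> f = Poly_Mapping.map_key (Poly_Mapping.map_key (Perm.apply \<sigma>)) f"

text \<open>Exact division: the unique polynomial \<open>q\<close> with \<open>q * g = f\<close>, when it exists.\<close>

definition poly_quot :: "'n ypoly \<Rightarrow> 'n ypoly \<Rightarrow> 'n ypoly"
  where "poly_quot f g = (THE q. q * g = f)"

definition poly_tensor ::
  "(complex \<Rightarrow> 'm::ab_group_add \<Rightarrow> 'm) \<Rightarrow> 'n ypoly \<Rightarrow> 'm \<Rightarrow> ('n, 'm) ypoly_tensor"
  where "poly_tensor scale f m = Poly_Mapping.map (\<lambda>a. scale a m) f"

definition poly_tensor_scale ::
  "(complex \<Rightarrow> 'm::ab_group_add \<Rightarrow> 'm) \<Rightarrow> complex \<Rightarrow> ('n, 'm) ypoly_tensor \<Rightarrow> ('n, 'm) ypoly_tensor"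
  where "poly_tensor_scale scale a v = Poly_Mapping.map (scale a) v"

text \<open>A monomial evaluated in the algebra; the chosen order of the factors is irrelevant since
  the \<open>y i\<close> commute there.\<close>

definition y_monomial :: "complex \<Rightarrow> ('n::finite \<Rightarrow>\<^sub>0 nat) \<Rightarrow> 'n gen free_alg set" where
  "y_monomial u \<alpha> = H_class u (Poly_Mapping.single
     (Word (map GY (SOME l. \<forall>i. count_list l i = Poly_Mapping.lookup \<alpha> i))) 1)"

text \<open>The identification of \<open>\<complex>[y] \<otimes> M\<close> with the induced module, \<open>f \<otimes> m \<mapsto> f(y) \<otimes> m\<close>.\<close>

definition ind_embed ::
  "complex \<Rightarrow> (complex \<Rightarrow> 'm::ab_group_add \<Rightarrow> 'm) \<Rightarrow> ('n::finite \<Rightarrow> 'm \<Rightarrow> 'm) \<Rightarrow> ('n perm \<Rightarrow> 'm \<Rightarrow> 'm)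
     \<Rightarrow> ('n, 'm) ypoly_tensor \<Rightarrow> ('n gen free_alg set \<times> 'm \<Rightarrow>\<^sub>0 int) set" where
  "ind_embed u scale c w v =
     tensor_class (H_alg u) (Hx u) (Hx_action u scale c w)
       (\<Sum>\<alpha>\<in>Poly_Mapping.keys v. frag_of (y_monomial u \<alpha>, Poly_Mapping.lookup v \<alpha>))"

text \<open>The action of the algebra on \<open>\<complex>[y] \<otimes> M\<close>, transported from the induced module.\<close>

definition Mx_action ::
  "complex \<Rightarrow> (complex \<Rightarrow> 'm::ab_group_add \<Rightarrow> 'm) \<Rightarrow> ('n::finite \<Rightarrow> 'm \<Rightarrow> 'm) \<Rightarrow> ('n perm \<Rightarrow> 'm \<Rightarrow> 'm)
     \<Rightarrow> 'n gen free_alg set \<Rightarrow> ('n, 'm) ypoly_tensor \<Rightarrow> ('n, 'm) ypoly_tensor" where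
  "Mx_action u scale c w h v =
     inv_into UNIV (ind_embed u scale c w)
       (tensor_left_action (H_alg u) (Hx u) (Hx_action u scale c w) h (ind_embed u scale c w v))"

end

theory Submission
  imports Defs "HOL-Library.Multiset"
begin

text \<open>
  The divided differences \<open>(f - s f) / (y i - y k)\<close> make sense for polynomials with coefficients in
  \<open>M\<close>, and the resulting Dunkl operators together with multiplication by the \<open>y i\<close> and the natural
  actions of \<open>c i\<close> and \<open>W\<close> satisfy all relations of the algebra.  The only hard relation is
  \<open>x i x j = x j x i\<close>: the commutator commutes with every \<open>y l\<close> and kills constants.  Hence
  \<open>\<complex>[y] \<otimes> M\<close> is a module, and acting on constants gives a map from the induced module to
  \<open>\<complex>[y] \<otimes> M\<close> that is left inverse to the identification map, which is therefore injective without
  the full triangular decomposition.  Since the relations allow moving the \<open>y i\<close> to the left, the image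
  of the identification map is stable under the algebra, so the two actions agree.
\<close>

section \<open>Additive maps on finitely supported functions\<close>

text \<open>The obstacle is that the objects of the statement are given by choice: the action on
  \<open>M\<close> by \<open>SOME\<close>, the quotient by \<open>THE\<close>, the transported
  action by \<open>inv_into\<close>. Moreover \<open>Hx u\<close> is a subalgebra of a quotient,
  with no presentation at hand, so an action on \<open>M\<close> cannot simply be prescribed on its
  generators. One concrete module removes both difficulties: its constants supply the action of
  \<open>Hx u\<close> on \<open>M\<close>, and applying elements of the algebra to constants
  recovers the coefficients of a tensor. Since \<open>M\<close> has no product, multiplication by
  \<open>y i\<close> becomes an operator on polynomials with coefficients in a group, and division
  by \<open>y i - y k\<close> becomes an equation in these operators. The Dunkl formula itself is
  forced: \<open>x i\<close> kills the constants, and the commutators of \<open>x i\<close> with the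
  \<open>y j\<close> determine it on all monomials.\<close>

definition lin_ext :: "('k \<Rightarrow> 'a \<Rightarrow> 'b) \<Rightarrow> ('k \<Rightarrow>\<^sub>0 'a::ab_group_add) \<Rightarrow> 'b::ab_group_add"
  where "lin_ext F v = (\<Sum>k\<in>Poly_Mapping.keys v. F k (Poly_Mapping.lookup v k))"

lemma lin_ext_add:
  assumes "\<And>k. additive (F k)"
  shows "lin_ext F (v + v') = lin_ext F v + lin_ext F v'"
  unfolding lin_ext_def
  using assms by (intro setsum_keys_plus_distrib) (auto simp: additive.zero additive.add)

lemma additive_lin_ext: "(\<And>k. additive (F k)) \<Longrightarrow> additive (lin_ext F)"
  by (simp add: additive_def lin_ext_add)

lemma lin_ext_single: "additive (F k) \<Longrightarrow> lin_ext F (Poly_Mapping.single k a) = F k a"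
  by (auto simp: lin_ext_def additive.zero)

lemma sum_single_lookup:
  "(\<Sum>k\<in>Poly_Mapping.keys v. Poly_Mapping.single k (Poly_Mapping.lookup v k)) = v"
proof (rule poly_mapping_eqI)
  show "Poly_Mapping.lookup (\<Sum>k\<in>Poly_Mapping.keys v. Poly_Mapping.single k (Poly_Mapping.lookup v k)) x
      = Poly_Mapping.lookup v x" for x
    by (simp add: lookup_sum lookup_single when_def sum.delta in_keys_iff)
qed

lemma additive_eqI:
  fixes v :: "'k \<Rightarrow>\<^sub>0 'a::ab_group_add"
  assumes "additive A" "additive B"
    and "\<And>k a. A (Poly_Mapping.single k a) = B (Poly_Mapping.single k a)"
  shows "A v = B v"
proof -
  have "A v = A (\<Sum>k\<in>Poly_Mapping.keys v. Poly_Mapping.single k (Poly_Mapping.lookup v k))"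
    by (simp add: sum_single_lookup)
  also have "\<dots> = B (\<Sum>k\<in>Poly_Mapping.keys v. Poly_Mapping.single k (Poly_Mapping.lookup v k))"
    by (simp add: additive.sum assms)
  finally show ?thesis by (simp add: sum_single_lookup)
qed

lemma poly_mapping_single_induct [case_names single add]:
  fixes v :: "'k \<Rightarrow>\<^sub>0 'a::comm_monoid_add"
  assumes "\<And>k a. P (Poly_Mapping.single k a)" "\<And>v v'. P v \<Longrightarrow> P v' \<Longrightarrow> P (v + v')"
  shows "P v"
proof -
  have "P 0"
    using assms(1)[of undefined 0] by simp
  then have "P (\<Sum>k\<in>A. Poly_Mapping.single k (Poly_Mapping.lookup v k))" for A
    by (induction A rule: infinite_finite_induct) (auto intro: assms)
  then show ?thesis
    by (metis sum_single_lookup)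
qed

text \<open>The rules for the variables are known for one \<open>y j\<close> at a time, so monomials
  are built up by raising one exponent by one.\<close>

lemma exponent_induct [case_names zero add_single]:
  fixes \<alpha> :: "'n \<Rightarrow>\<^sub>0 nat"
  assumes "P 0" "\<And>\<alpha> j. P \<alpha> \<Longrightarrow> P (\<alpha> + Poly_Mapping.single j 1)"
  shows "P \<alpha>"
proof (induction \<alpha> rule: update_induct)
  case const
  then show ?case by (rule assms(1))
next
  case (update \<alpha> j b)
  have "P (\<alpha> + Poly_Mapping.single j n)" for n
  proof (induction n)
    case 0
    then show ?case using update by simp
  next
    case (Suc n)
    have "\<alpha> + Poly_Mapping.single j (Suc n) = \<alpha> + Poly_Mapping.single j n + Poly_Mapping.single j 1"
      by (simp add: add.assoc single_add[symmetric])
    then show ?case using Suc assms(2) by metis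
  qed
  moreover have "Poly_Mapping.update j b \<alpha> = \<alpha> + Poly_Mapping.single j b"
    using update(1)
    by (intro poly_mapping_eqI) (auto simp: lookup_update lookup_add lookup_single in_keys_iff when_def)
  ultimately show ?case by simp
qed

lemma lookup_map:
  "f 0 = 0 \<Longrightarrow> Poly_Mapping.lookup (Poly_Mapping.map f v) k = f (Poly_Mapping.lookup v k)"
  by (simp add: map.rep_eq when_def)

lemma additive_map: "additive f \<Longrightarrow> additive (Poly_Mapping.map f)"
  unfolding additive_def
  by (intro allI poly_mapping_eqI)
    (simp add: lookup_map lookup_add additive.zero[unfolded additive_def])

lemma map_add:
  "additive f \<Longrightarrow> Poly_Mapping.map f (v + v') = Poly_Mapping.map f v + Poly_Mapping.map f v'"
  by (simp add: additive.add[OF additive_map])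

lemma additive_single: "additive (Poly_Mapping.single k)"
  by (simp add: additive_def single_add)

section \<open>Divided differences\<close>

text \<open>Multiplication by \<open>y j\<close>, for coefficients that can be added but not
  multiplied.\<close>

definition shift :: "'n \<Rightarrow> (('n \<Rightarrow>\<^sub>0 nat) \<Rightarrow>\<^sub>0 'a::ab_group_add) \<Rightarrow> ('n \<Rightarrow>\<^sub>0 nat) \<Rightarrow>\<^sub>0 'a"
  where "shift j = lin_ext (\<lambda>\<alpha>. Poly_Mapping.single (\<alpha> + Poly_Mapping.single j 1))"

lemma additive_shift: "additive (shift j)"
  unfolding shift_def by (intro additive_lin_ext additive_single)

lemma shift_single:
  "shift j (Poly_Mapping.single \<alpha> a) = Poly_Mapping.single (\<alpha> + Poly_Mapping.single j 1) a"
  unfolding shift_def by (intro lin_ext_single additive_single)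

lemma lookup_shift:
  "Poly_Mapping.lookup (shift j v) (\<alpha> + Poly_Mapping.single j 1) = Poly_Mapping.lookup v \<alpha>"
  by (simp add: shift_def lin_ext_def lookup_sum lookup_single when_def sum.delta in_keys_iff)

lemma keys_shift:
  "Poly_Mapping.keys (shift j v) \<subseteq> (\<lambda>\<alpha>. \<alpha> + Poly_Mapping.single j 1) ` Poly_Mapping.keys v"
  unfolding shift_def lin_ext_def
  by (rule order_trans[OF keys_sum]) (auto split: if_splits)

lemmas shift_add = additive.add[OF additive_shift]

lemma shift_commute: "shift i (shift j v) = shift j (shift i v)"
  by (rule additive_eqI[of "\<lambda>v. shift i (shift j v)"]; (intro additive.intro)?)
    (simp_all add: shift_add shift_single add_ac)

lemma map_shift:
  assumes "additive f"
  shows "Poly_Mapping.map f (shift j v) = shift j (Poly_Mapping.map f v)"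
  by (rule additive_eqI[of "\<lambda>v. Poly_Mapping.map f (shift j v)"]; (intro additive.intro)?)
    (simp_all add: shift_add map_add assms shift_single map_single additive.zero)

text \<open>Compare the monomials with the largest exponent of \<open>y i\<close>.\<close>

lemma shift_inject:
  assumes "i \<noteq> k" "shift i q - shift k q = shift i q' - shift k q'"
  shows "q = q'"
proof (rule ccontr)
  assume "q \<noteq> q'"
  define p where "p = q - q'"
  have eq: "shift i p = shift k p"
    using assms(2) by (simp add: p_def additive.diff[OF additive_shift] algebra_simps)
  have "Poly_Mapping.keys p \<noteq> {}"
    using \<open>q \<noteq> q'\<close> by (simp add: p_def)
  then obtain \<alpha> where \<alpha>: "\<alpha> \<in> Poly_Mapping.keys p"
    and "Poly_Mapping.lookup \<alpha> i = Max ((\<lambda>\<beta>. Poly_Mapping.lookup \<beta> i) ` Poly_Mapping.keys p)"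
    using Max_in[of "(\<lambda>\<beta>. Poly_Mapping.lookup \<beta> i) ` Poly_Mapping.keys p"] by fastforce
  then have max: "Poly_Mapping.lookup \<beta> i \<le> Poly_Mapping.lookup \<alpha> i" if "\<beta> \<in> Poly_Mapping.keys p" for \<beta>
    using that by simp
  have "\<alpha> + Poly_Mapping.single i 1 \<in> Poly_Mapping.keys (shift k p)"
    using \<alpha> lookup_shift[of i p \<alpha>] by (simp add: in_keys_iff eq)
  then obtain \<beta> where \<beta>: "\<beta> \<in> Poly_Mapping.keys p"
    "\<alpha> + Poly_Mapping.single i 1 = \<beta> + Poly_Mapping.single k 1"
    using keys_shift[of k p] by auto
  have "Poly_Mapping.lookup \<beta> i = Poly_Mapping.lookup \<alpha> i + 1"
    using arg_cong[OF \<beta>(2), of "\<lambda>\<gamma>. Poly_Mapping.lookup \<gamma> i"] \<open>i \<noteq> k\<close>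
    by (simp add: lookup_add lookup_single when_def)
  then show False
    using max[OF \<beta>(1)] by simp
qed

section \<open>Permutation of the variables\<close>

definition perm_exp :: "'n perm \<Rightarrow> ('n \<Rightarrow>\<^sub>0 nat) \<Rightarrow> 'n \<Rightarrow>\<^sub>0 nat"
  where "perm_exp \<sigma> = Poly_Mapping.map_key (Perm.apply (inverse \<sigma>))"

text \<open>The formula of \<open>perm_poly\<close>, for arbitrary coefficients. Reading off the
  coefficient at \<alpha> composed with \<sigma> moves a monomial by the inverse of that
  composition, which is \<open>perm_exp\<close>.\<close>

definition perm_vars :: "'n perm \<Rightarrow> (('n \<Rightarrow>\<^sub>0 nat) \<Rightarrow>\<^sub>0 'a::ab_group_add) \<Rightarrow> ('n \<Rightarrow>\<^sub>0 nat) \<Rightarrow>\<^sub>0 'a"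
  where "perm_vars \<sigma> = Poly_Mapping.map_key (Poly_Mapping.map_key (Perm.apply \<sigma>))"

lemma inj_apply_perm: "inj (Perm.apply \<sigma>)"
  by (simp add: bij_is_inj)

lemma apply_inverse_cancel [simp]:
  "Perm.apply (inverse \<sigma>) (Perm.apply \<sigma> a) = a" "Perm.apply \<sigma> (Perm.apply (inverse \<sigma>) a) = a"
  by (simp_all add: apply_inverse inj_apply_perm surj_f_inv_f bij_is_surj)

lemma lookup_perm_exp:
  "Poly_Mapping.lookup (perm_exp \<sigma> \<alpha>) j = Poly_Mapping.lookup \<alpha> (Perm.apply (inverse \<sigma>) j)"
  by (simp add: perm_exp_def map_key.rep_eq inj_apply_perm)

lemma perm_exp_inverse: "Poly_Mapping.map_key (Perm.apply \<sigma>) (perm_exp \<sigma> \<alpha>) = \<alpha>"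
  by (intro poly_mapping_eqI) (simp add: map_key.rep_eq inj_apply_perm lookup_perm_exp)

text \<open>\<open>map_key\<close> is composition only along an injective map; the outer
  \<open>map_key\<close> in \<open>perm_vars\<close> runs along this one.\<close>

lemma inj_map_key_perm: "inj (Poly_Mapping.map_key (Perm.apply \<sigma>) :: ('n \<Rightarrow>\<^sub>0 nat) \<Rightarrow> _)"
proof (rule injI, rule poly_mapping_eqI)
  fix \<alpha> \<beta> :: "'n \<Rightarrow>\<^sub>0 nat" and j
  assume "Poly_Mapping.map_key (Perm.apply \<sigma>) \<alpha> = Poly_Mapping.map_key (Perm.apply \<sigma>) \<beta>"
  then have "Poly_Mapping.lookup \<alpha> \<circ> Perm.apply \<sigma> = Poly_Mapping.lookup \<beta> \<circ> Perm.apply \<sigma>"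
    by (metis inj_apply_perm map_key.rep_eq)
  from fun_cong[OF this, of "Perm.apply (inverse \<sigma>) j"]
  show "Poly_Mapping.lookup \<alpha> j = Poly_Mapping.lookup \<beta> j"
    by simp
qed

lemma perm_vars_single:
  "perm_vars \<sigma> (Poly_Mapping.single \<alpha> a) = Poly_Mapping.single (perm_exp \<sigma> \<alpha>) a"
  using map_key_single[OF inj_map_key_perm, of \<sigma> "perm_exp \<sigma> \<alpha>" a]
  by (simp add: perm_vars_def perm_exp_inverse)

lemma additive_perm_vars: "additive (perm_vars \<sigma>)"
  by (simp add: additive_def perm_vars_def map_key_plus inj_map_key_perm)

lemmas perm_vars_add = additive.add[OF additive_perm_vars]

lemma perm_exp_0 [simp]: "perm_exp \<sigma> 0 = 0"
  by (intro poly_mapping_eqI) (simp add: lookup_perm_exp)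

lemma perm_exp_add: "perm_exp \<sigma> (\<alpha> + \<beta>) = perm_exp \<sigma> \<alpha> + perm_exp \<sigma> \<beta>"
  by (intro poly_mapping_eqI) (simp add: lookup_perm_exp lookup_add)

lemma perm_exp_single: "perm_exp \<sigma> (Poly_Mapping.single j n) = Poly_Mapping.single (Perm.apply \<sigma> j) n"
  by (intro poly_mapping_eqI) (auto simp: lookup_perm_exp lookup_single when_def)

lemma perm_exp_one [simp]: "perm_exp 1 \<alpha> = \<alpha>"
  by (intro poly_mapping_eqI) (simp add: lookup_perm_exp apply_inverse)

lemma perm_exp_mult: "perm_exp (\<sigma> * \<tau>) \<alpha> = perm_exp \<sigma> (perm_exp \<tau> \<alpha>)"
proof (induction \<alpha> rule: exponent_induct)
  case (add_single \<alpha> j)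
  then show ?case by (simp add: perm_exp_add perm_exp_single apply_times)
qed simp

lemma perm_vars_one [simp]: "perm_vars 1 v = v"
  by (rule additive_eqI[of "perm_vars 1"]; (intro additive.intro)?)
    (simp_all add: perm_vars_single perm_vars_add)

lemma perm_vars_mult: "perm_vars (\<sigma> * \<tau>) v = perm_vars \<sigma> (perm_vars \<tau> v)"
  by (rule additive_eqI[of "perm_vars (\<sigma> * \<tau>)"]; (intro additive.intro)?)
    (simp_all add: perm_vars_add perm_vars_single perm_exp_mult)

lemma perm_vars_shift: "perm_vars \<sigma> (shift j v) = shift (Perm.apply \<sigma> j) (perm_vars \<sigma> v)"
  by (rule additive_eqI[of "\<lambda>v. perm_vars \<sigma> (shift j v)"]; (intro additive.intro)?)
    (simp_all add: perm_vars_add shift_add perm_vars_single shift_single perm_exp_add perm_exp_single)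

lemma map_perm_vars:
  assumes "additive f"
  shows "Poly_Mapping.map f (perm_vars \<sigma> v) = perm_vars \<sigma> (Poly_Mapping.map f v)"
  by (rule additive_eqI[of "\<lambda>v. Poly_Mapping.map f (perm_vars \<sigma> v)"]; (intro additive.intro)?)
    (simp_all add: perm_vars_add map_add assms perm_vars_single map_single additive.zero)

text \<open>The quotient of \<open>v - s v\<close> by \<open>y i - y k\<close>, with
  \<open>s\<close> the transposition. For complex coefficients the equation is the one in
  \<open>poly_quot\<close>; here it also makes sense over \<open>M\<close>.\<close>

definition ddiff ::
  "'n \<Rightarrow> 'n \<Rightarrow> (('n \<Rightarrow>\<^sub>0 nat) \<Rightarrow>\<^sub>0 'a::ab_group_add) \<Rightarrow> ('n \<Rightarrow>\<^sub>0 nat) \<Rightarrow>\<^sub>0 'a"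
  where "ddiff i k v = (THE q. shift i q - shift k q = v - perm_vars (Perm.swap k i) v)"

lemma apply_swap:
  "Perm.apply (Perm.swap k i) j = (if j = i then k else if j = k then i else j)"
  by (cases "j = i"; cases "j = k"; cases "i = k") (auto simp: swap.rep_eq transpose_def)

text \<open>Twisted Leibniz rule:
  \<open>y j v - s (y j v) = y j (v - s v) + (y j - y (s j)) (s v)\<close>, and
  \<open>y j - y (s j)\<close> is \<open>y i - y k\<close>, its negative or 0 according to
  \<open>j\<close>. It serves twice: as induction step for divisibility and as source of the
  commutators with the variables.\<close>

lemma ddiff_equation_shift:
  fixes i j k :: 'n
  assumes "i \<noteq> k" and "shift i q - shift k q = v - perm_vars (Perm.swap k i) v"
  defines "q' \<equiv> shift j q +
    (if j = i then perm_vars (Perm.swap k i) v else if j = k then - perm_vars (Perm.swap k i) v else 0)"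
  shows "shift i q' - shift k q' = shift j v - perm_vars (Perm.swap k i) (shift j v)"
proof -
  have "shift i (shift j q) - shift k (shift j q) = shift j (shift i q - shift k q)"
    by (simp add: additive.diff[OF additive_shift] shift_commute)
  also have "\<dots> = shift j v - shift j (perm_vars (Perm.swap k i) v)"
    by (simp add: assms(2) additive.diff[OF additive_shift])
  finally show ?thesis
    using assms(1)
    by (auto simp: q'_def perm_vars_shift apply_swap shift_add
        additive.minus[OF additive_shift] additive.zero[OF additive_shift] algebra_simps)
qed

lemma ddiff_exists:
  assumes "i \<noteq> k"
  shows "\<exists>q. shift i q - shift k q = v - perm_vars (Perm.swap k i) v"
proof (induction v rule: poly_mapping_single_induct)
  case (single \<alpha> a)
  show ?case
  proof (induction \<alpha> rule: exponent_induct)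
    case zero
    show ?case
      by (intro exI[of _ 0]) (simp add: perm_vars_single additive.zero[OF additive_shift])
  next
    case (add_single \<alpha> j)
    then show ?case
      using ddiff_equation_shift[OF assms, of _ _ j] by (metis shift_single)
  qed
next
  case (add v v')
  then obtain q q' where "shift i q - shift k q = v - perm_vars (Perm.swap k i) v"
    "shift i q' - shift k q' = v' - perm_vars (Perm.swap k i) v'"
    by blast
  then show ?case
    by (intro exI[of _ "q + q'"])
      (simp add: additive.add[OF additive_shift] additive.add[OF additive_perm_vars] algebra_simps)
qed

text \<open>All further properties of \<open>ddiff\<close> are obtained by checking the defining
  equation for a candidate, so the description is never unfolded into coefficients.\<close>

lemma ddiff_eqI:
  assumes "i \<noteq> k" "shift i q - shift k q = v - perm_vars (Perm.swap k i) v"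
  shows "ddiff i k v = q"
  unfolding ddiff_def using assms by (intro the_equality) (auto intro: shift_inject)

lemma ddiff:
  assumes "i \<noteq> k"
  shows "shift i (ddiff i k v) - shift k (ddiff i k v) = v - perm_vars (Perm.swap k i) v"
  using ddiff_exists[OF assms] ddiff_eqI[OF assms] by metis

lemma additive_ddiff:
  assumes "i \<noteq> k"
  shows "additive (ddiff i k)"
proof
  show "ddiff i k (v + v') = ddiff i k v + ddiff i k v'" for v v' :: "('a \<Rightarrow>\<^sub>0 nat) \<Rightarrow>\<^sub>0 'b"
    using ddiff[OF assms, of v] ddiff[OF assms, of v']
    by (intro ddiff_eqI[OF assms])
      (simp add: additive.add[OF additive_shift] additive.add[OF additive_perm_vars] algebra_simps)
qed

lemma ddiff_single_0:
  assumes "i \<noteq> k"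
  shows "ddiff i k (Poly_Mapping.single 0 a) = 0"
  by (intro ddiff_eqI[OF assms]) (simp add: perm_vars_single additive.zero[OF additive_shift])

lemma ddiff_map:
  assumes "i \<noteq> k" "additive f"
  shows "ddiff i k (Poly_Mapping.map f v) = Poly_Mapping.map f (ddiff i k v)"
  using arg_cong[OF ddiff[OF assms(1), of v], of "Poly_Mapping.map f"]
  by (intro ddiff_eqI[OF assms(1)])
    (simp add: additive.diff[OF additive_map] assms(2) map_shift map_perm_vars)

lemma swap_conj: "\<sigma> * Perm.swap k i = Perm.swap (Perm.apply \<sigma> k) (Perm.apply \<sigma> i) * \<sigma>"
  by (rule perm_eqI) (simp add: apply_times apply_swap apply_inj)

text \<open>Apply \<sigma> to the defining equation; conjugation turns the transposition of
  \<open>k\<close> and \<open>i\<close> into that of their images.\<close>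

lemma ddiff_perm_vars:
  assumes "i \<noteq> k"
  shows "ddiff (Perm.apply \<sigma> i) (Perm.apply \<sigma> k) (perm_vars \<sigma> v) = perm_vars \<sigma> (ddiff i k v)"
  using arg_cong[OF ddiff[OF assms, of v], of "perm_vars \<sigma>"] assms
  by (intro ddiff_eqI)
    (simp_all add: apply_inj additive.diff[OF additive_perm_vars] perm_vars_shift
      flip: perm_vars_mult swap_conj)

lemma ddiff_shift:
  assumes "i \<noteq> k"
  shows "ddiff i k (shift j v) = shift j (ddiff i k v) +
    (if j = i then perm_vars (Perm.swap k i) v else if j = k then - perm_vars (Perm.swap k i) v else 0)"
  by (intro ddiff_eqI[OF assms] ddiff_equation_shift ddiff assms)

section \<open>Representations of free algebras\<close>

text \<open>\<open>foldr\<close> lets the last letter act first, so that concatenation of words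
  becomes composition and a left action results.\<close>

definition word_op :: "('g \<Rightarrow> 'v \<Rightarrow> 'v) \<Rightarrow> 'g word \<Rightarrow> 'v \<Rightarrow> 'v"
  where "word_op g x v = foldr g (letters x) v"

lemma word_op_add: "word_op g (x + y) v = word_op g x (word_op g y v)"
  by (simp add: word_op_def plus_word_def)

lemma word_op_zero [simp]: "word_op g 0 v = v"
  by (simp add: word_op_def zero_word_def)

text \<open>The universal property of the free algebra: any family of linear operators, one per
  generator, extends to a representation.\<close>

locale free_rep = vector_space s
  for s :: "complex \<Rightarrow> 'v::ab_group_add \<Rightarrow> 'v" +
  fixes g :: "'g \<Rightarrow> 'v \<Rightarrow> 'v"
  assumes g_add: "g x (v + v') = g x v + g x v'"
    and g_scale: "g x (s a v) = s a (g x v)"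
begin

definition act :: "'g free_alg \<Rightarrow> 'v \<Rightarrow> 'v"
  where "act a v = lin_ext (\<lambda>x k. s k (word_op g x v)) a"

lemma word_op_vec_add: "word_op g x (v + v') = word_op g x v + word_op g x v'"
proof -
  have "foldr g gs (v + v') = foldr g gs v + foldr g gs v'" for gs
    by (induction gs) (simp_all add: g_add)
  then show ?thesis by (simp add: word_op_def)
qed

lemma word_op_scale: "word_op g x (s a v) = s a (word_op g x v)"
proof -
  have "foldr g gs (s a v) = s a (foldr g gs v)" for gs
    by (induction gs) (simp_all add: g_scale)
  then show ?thesis by (simp add: word_op_def)
qed

lemma act_add: "act (a + b) v = act a v + act b v"
  unfolding act_def by (rule lin_ext_add) (simp add: additive_def scale_left_distrib)

lemma act_single: "act (Poly_Mapping.single x k) v = s k (word_op g x v)"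
  unfolding act_def by (rule lin_ext_single) (simp add: additive_def scale_left_distrib)

lemma act_zero [simp]: "act 0 v = 0"
  using act_add[of 0 0 v] by simp

lemma act_minus: "act (a - b) v = act a v - act b v"
  using act_add[of "a - b" b v] by (simp add: algebra_simps)

lemma act_uminus: "act (- a) v = - act a v"
  using act_minus[of 0 a v] by simp

lemma act_sum: "act (\<Sum>k\<in>A. a k) v = (\<Sum>k\<in>A. act (a k) v)"
  by (induction A rule: infinite_finite_induct) (simp_all add: act_add)

lemma act_vec_add: "act a (v + v') = act a v + act a v'"
  by (induction a rule: poly_mapping_single_induct)
    (simp_all add: act_single act_add word_op_vec_add scale_right_distrib)

lemma additive_act: "additive (act a)"
  by (simp add: additive_def act_vec_add)

lemma act_one [simp]: "act 1 v = v"
  using act_single[of 0 1 v] by simp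

lemma act_mult: "act (a * b) v = act a (act b v)"
proof (induction a rule: poly_mapping_single_induct)
  case (single x k)
  show ?case
    by (induction b rule: poly_mapping_single_induct)
      (simp_all add: mult_single act_single act_add word_op_add word_op_vec_add word_op_scale
        scale_right_distrib distrib_left)
qed (simp add: distrib_right act_add)

lemma act_generator: "act (Poly_Mapping.single (Word [x]) 1) v = g x v"
  by (simp add: act_single word_op_def)

end

section \<open>Dunkl operators\<close>

lemma map_map_additive:
  "additive f \<Longrightarrow> additive g \<Longrightarrow>
    Poly_Mapping.map f (Poly_Mapping.map g v) = Poly_Mapping.map (\<lambda>x. f (g x)) v"
  by (intro poly_mapping_eqI) (simp add: lookup_map additive.zero)

locale dunkl_module = K_module scale c w
  for scale :: "complex \<Rightarrow> 'm::ab_group_add \<Rightarrow> 'm"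
    and c :: "'n::finite \<Rightarrow> 'm \<Rightarrow> 'm"
    and w :: "'n perm \<Rightarrow> 'm \<Rightarrow> 'm" +
  fixes u :: complex
begin

lemma c_add: "c i (m + m') = c i m + c i m'"
proof -
  interpret Vector_Spaces.linear scale scale "c i" by (rule c_linear)
  show ?thesis by (rule add)
qed

lemma c_scale: "c i (scale a m) = scale a (c i m)"
proof -
  interpret Vector_Spaces.linear scale scale "c i" by (rule c_linear)
  show ?thesis by (rule scale)
qed

lemma w_add: "w \<sigma> (m + m') = w \<sigma> m + w \<sigma> m'"
proof -
  interpret Vector_Spaces.linear scale scale "w \<sigma>" by (rule w_linear)
  show ?thesis by (rule add)
qed

lemma w_scale: "w \<sigma> (scale a m) = scale a (w \<sigma> m)"
proof -
  interpret Vector_Spaces.linear scale scale "w \<sigma>" by (rule w_linear)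
  show ?thesis by (rule scale)
qed

lemma additive_c: "additive (c i)"
  by (simp add: additive_def c_add)

lemma additive_w: "additive (w \<sigma>)"
  by (simp add: additive_def w_add)

lemma additive_scale: "additive (scale a)"
  by (simp add: additive_def scale_right_distrib)

lemma w_c_swap: "w \<sigma> (c i m) = c (Perm.apply \<sigma> i) (w \<sigma> m)"
  using w_c[of \<sigma> i "w \<sigma> m"] w_mult[of "inverse \<sigma>" \<sigma> m] by (simp add: w_one)

abbreviation smul :: "complex \<Rightarrow> ('n, 'm) ypoly_tensor \<Rightarrow> ('n, 'm) ypoly_tensor"
  where "smul \<equiv> poly_tensor_scale scale"

definition c_op :: "'n \<Rightarrow> ('n, 'm) ypoly_tensor \<Rightarrow> ('n, 'm) ypoly_tensor"
  where "c_op i = Poly_Mapping.map (c i)"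

definition w_op :: "'n perm \<Rightarrow> ('n, 'm) ypoly_tensor \<Rightarrow> ('n, 'm) ypoly_tensor"
  where "w_op \<sigma> v = Poly_Mapping.map (w \<sigma>) (perm_vars \<sigma> v)"

definition refl_coeff :: "'n \<Rightarrow> 'n \<Rightarrow> 'm \<Rightarrow> 'm"
  where "refl_coeff k i m = w (Perm.swap k i) m + c k (c i (w (Perm.swap k i) m))"

definition dunkl :: "'n \<Rightarrow> ('n, 'm) ypoly_tensor \<Rightarrow> ('n, 'm) ypoly_tensor"
  where "dunkl i v = smul u (\<Sum>k\<in>UNIV - {i}. Poly_Mapping.map (refl_coeff k i) (ddiff i k v))"

text \<open>The element \<open>(1 + c k c i) s\<close> acting on the whole space, variables
  included, whereas \<open>refl_coeff\<close> acts on \<open>M\<close> alone. The latter accompanies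
  the divided differences, the former appears in the commutators.\<close>

definition refl_op :: "'n \<Rightarrow> 'n \<Rightarrow> ('n, 'm) ypoly_tensor \<Rightarrow> ('n, 'm) ypoly_tensor"
  where "refl_op k i v = Poly_Mapping.map (refl_coeff k i) (perm_vars (Perm.swap k i) v)"

lemma additive_refl_coeff: "additive (refl_coeff k i)"
  by (simp add: additive_def refl_coeff_def c_add w_add)

lemma refl_coeff_scale: "refl_coeff k i (scale a m) = scale a (refl_coeff k i m)"
  by (simp add: refl_coeff_def c_scale w_scale scale_right_distrib)

lemma additive_smul: "additive (smul a)"
  unfolding poly_tensor_scale_def[abs_def] by (intro additive_map additive_scale)

lemma additive_c_op: "additive (c_op i)"
  unfolding c_op_def by (intro additive_map additive_c)

lemma c_op_add: "c_op i (v + v') = c_op i v + c_op i v'"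
  by (rule additive.add[OF additive_c_op])

lemma w_op_add: "w_op \<sigma> (v + v') = w_op \<sigma> v + w_op \<sigma> v'"
  by (simp add: w_op_def perm_vars_add map_add additive_w)

lemma additive_w_op: "additive (w_op \<sigma>)"
  by (simp add: additive_def w_op_add)

lemma smul_map:
  assumes "additive f" "\<And>a m. f (scale a m) = scale a (f m)"
  shows "Poly_Mapping.map f (smul a v) = smul a (Poly_Mapping.map f v)"
  by (simp add: poly_tensor_scale_def map_map_additive assms additive_scale)

lemma c_op_smul: "c_op i (smul a v) = smul a (c_op i v)"
  unfolding c_op_def by (intro smul_map additive_c c_scale)

lemma shift_smul: "shift i (smul a v) = smul a (shift i v)"
  unfolding poly_tensor_scale_def by (simp add: map_shift additive_scale)

lemma perm_vars_smul: "perm_vars \<sigma> (smul a v) = smul a (perm_vars \<sigma> v)"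
  unfolding poly_tensor_scale_def by (simp add: map_perm_vars additive_scale)

lemma w_op_smul: "w_op \<sigma> (smul a v) = smul a (w_op \<sigma> v)"
  unfolding w_op_def perm_vars_smul by (intro smul_map additive_w w_scale)

lemma smul_smul: "smul a (smul b v) = smul (a * b) v"
  unfolding poly_tensor_scale_def by (simp add: map_map_additive additive_scale)

lemma dunkl_add: "dunkl i (v + v') = dunkl i v + dunkl i v'"
proof -
  have "(\<Sum>k\<in>UNIV - {i}. Poly_Mapping.map (refl_coeff k i) (ddiff i k (v + v')))
    = (\<Sum>k\<in>UNIV - {i}. Poly_Mapping.map (refl_coeff k i) (ddiff i k v))
      + (\<Sum>k\<in>UNIV - {i}. Poly_Mapping.map (refl_coeff k i) (ddiff i k v'))"
    unfolding sum.distrib[symmetric]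
    by (rule sum.cong) (auto simp: additive.add[OF additive_ddiff] map_add additive_refl_coeff)
  then show ?thesis by (simp add: dunkl_def additive.add[OF additive_smul])
qed

lemma additive_dunkl: "additive (dunkl i)"
  by (simp add: additive_def dunkl_add)

text \<open>Two maps \<open>f\<close> and \<open>f'\<close> are allowed so that one argument covers
  commutation (scalars and \<open>c j\<close> with \<open>j\<close> different from \<open>i\<close>)
  and anticommutation, where \<open>f'\<close> is minus \<open>c i\<close>.\<close>

lemma dunkl_map:
  assumes "additive f" "additive f'" "\<And>a m. f' (scale a m) = scale a (f' m)"
    and "\<And>k m. k \<noteq> i \<Longrightarrow> refl_coeff k i (f m) = f' (refl_coeff k i m)"
  shows "dunkl i (Poly_Mapping.map f v) = Poly_Mapping.map f' (dunkl i v)"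
proof -
  have "Poly_Mapping.map (refl_coeff k i) (ddiff i k (Poly_Mapping.map f v))
    = Poly_Mapping.map f' (Poly_Mapping.map (refl_coeff k i) (ddiff i k v))" if "k \<noteq> i" for k
    using that assms by (simp add: ddiff_map map_map_additive additive_refl_coeff)
  then show ?thesis
    by (simp add: dunkl_def smul_map assms additive.sum[OF additive_map[OF assms(2)]])
qed

lemma dunkl_smul: "dunkl i (smul a v) = smul a (dunkl i v)"
  unfolding poly_tensor_scale_def[of scale a]
  by (intro dunkl_map additive_scale refl_coeff_scale) (simp add: mult.commute)

lemma dunkl_single_0 [simp]: "dunkl i (Poly_Mapping.single 0 m) = 0"
proof -
  have "(\<Sum>k\<in>UNIV - {i}. Poly_Mapping.map (refl_coeff k i) (ddiff i k (Poly_Mapping.single 0 m))) = 0"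
    by (rule sum.neutral) (auto simp: ddiff_single_0 additive.zero[OF additive_map[OF additive_refl_coeff]])
  then show ?thesis by (simp add: dunkl_def additive.zero[OF additive_smul])
qed

text \<open>The Leibniz correction occurs in every summand if \<open>j = i\<close>, but only in the
  summand \<open>k = j\<close> and with a minus sign otherwise. These are the two relations for the
  commutators of \<open>y j\<close> with \<open>x i\<close>.\<close>

lemma dunkl_shift:
  "dunkl i (shift j v) = shift j (dunkl i v)
    + (if j = i then smul u (\<Sum>k\<in>UNIV - {i}. refl_op k i v) else - smul u (refl_op j i v))"
proof -
  let ?T = "\<lambda>k. if j = i then refl_op k i v else if j = k then - refl_op k i v else 0"
  have "Poly_Mapping.map (refl_coeff k i) (ddiff i k (shift j v))
    = shift j (Poly_Mapping.map (refl_coeff k i) (ddiff i k v)) + ?T k" if "k \<noteq> i" for k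
    using that
    by (auto simp: ddiff_shift refl_op_def map_add additive_refl_coeff map_shift
        additive.minus[OF additive_map[OF additive_refl_coeff]] additive.zero[OF additive_map[OF additive_refl_coeff]])
  then have "dunkl i (shift j v) = smul u (\<Sum>k\<in>UNIV - {i}.
      shift j (Poly_Mapping.map (refl_coeff k i) (ddiff i k v)) + ?T k)"
    by (simp add: dunkl_def)
  also have "\<dots> = shift j (dunkl i v) + smul u (\<Sum>k\<in>UNIV - {i}. ?T k)"
    by (simp add: dunkl_def sum.distrib additive.add[OF additive_smul] shift_smul
        additive.sum[OF additive_shift])
  also have "smul u (\<Sum>k\<in>UNIV - {i}. ?T k)
    = (if j = i then smul u (\<Sum>k\<in>UNIV - {i}. refl_op k i v) else - smul u (refl_op j i v))"
    by (auto simp: additive.minus[OF additive_smul])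
  finally show ?thesis .
qed

section \<open>Commutation with the Clifford generators and the symmetric group\<close>

lemma c_op_square: "c_op i (c_op i v) = v"
  by (intro poly_mapping_eqI) (simp add: c_op_def lookup_map additive.zero[OF additive_c] c_square)

lemma c_op_anticommute: "i \<noteq> j \<Longrightarrow> c_op i (c_op j v) = - c_op j (c_op i v)"
  by (intro poly_mapping_eqI) (simp add: c_op_def lookup_map additive.zero[OF additive_c] c_anticommute[of i j])

lemma w_op_one: "w_op 1 v = v"
  by (intro poly_mapping_eqI) (simp add: w_op_def lookup_map additive.zero[OF additive_w] w_one)

lemma w_op_mult: "w_op (\<sigma> * \<tau>) v = w_op \<sigma> (w_op \<tau> v)"
  by (simp add: w_op_def map_perm_vars additive_w map_map_additive perm_vars_mult flip: w_mult)

lemma w_op_c_op: "w_op \<sigma> (c_op i v) = c_op (Perm.apply \<sigma> i) (w_op \<sigma> v)"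
  by (simp add: w_op_def c_op_def map_perm_vars[symmetric] additive_w additive_c map_map_additive w_c_swap)

lemma w_op_shift: "w_op \<sigma> (shift j v) = shift (Perm.apply \<sigma> j) (w_op \<sigma> v)"
  by (simp add: w_op_def perm_vars_shift map_shift additive_w)

lemma c_op_shift: "c_op i (shift j v) = shift j (c_op i v)"
  by (simp add: c_op_def map_shift additive_c)

lemma refl_op_eq: "refl_op k i v = w_op (Perm.swap k i) v + c_op k (c_op i (w_op (Perm.swap k i) v))"
  by (intro poly_mapping_eqI)
    (simp add: refl_op_def w_op_def c_op_def refl_coeff_def lookup_add lookup_map additive.zero[OF additive_c]
      additive.zero[OF additive_w])

lemma c_minus: "c i (- m) = - c i m"
  by (rule additive.minus[OF additive_c])

text \<open>Since \<open>s\<close> turns \<open>c i\<close> into \<open>c k\<close>, both sides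
  equal \<open>(c k - c i) s m\<close>.\<close>

lemma refl_coeff_c_same: "k \<noteq> i \<Longrightarrow> refl_coeff k i (c i m) = - c i (refl_coeff k i m)"
  by (simp add: refl_coeff_def w_c_swap apply_swap c_add c_anticommute[of i k] c_square c_minus)

text \<open>For \<open>j = k\<close> both sides are \<open>(c i + c k) s m\<close>; otherwise
  \<open>s\<close> fixes \<open>c j\<close>, which commutes with the even element
  \<open>c k c i\<close>.\<close>

lemma refl_coeff_c_other: "k \<noteq> i \<Longrightarrow> j \<noteq> i \<Longrightarrow> refl_coeff k i (c j m) = c j (refl_coeff k i m)"
  using c_anticommute[of i k] c_anticommute[of j k] c_anticommute[of j i]
  by (cases "j = k") (simp_all add: refl_coeff_def w_c_swap apply_swap c_add c_square c_minus)

lemma refl_coeff_w: "refl_coeff (Perm.apply \<sigma> k) (Perm.apply \<sigma> i) (w \<sigma> m) = w \<sigma> (refl_coeff k i m)"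
  by (simp add: refl_coeff_def w_add w_c_swap flip: w_mult swap_conj)

lemma dunkl_c_op_same: "dunkl i (c_op i v) = - c_op i (dunkl i v)"
proof -
  have "dunkl i (c_op i v) = Poly_Mapping.map (\<lambda>m. - c i m) (dunkl i v)"
    unfolding c_op_def
    by (intro dunkl_map additive_c refl_coeff_c_same) (simp_all add: additive_def c_add c_scale)
  also have "\<dots> = - c_op i (dunkl i v)"
    by (intro poly_mapping_eqI) (simp add: c_op_def lookup_map additive.zero[OF additive_c])
  finally show ?thesis .
qed

lemma dunkl_c_op_other: "i \<noteq> j \<Longrightarrow> dunkl i (c_op j v) = c_op j (dunkl i v)"
  unfolding c_op_def by (intro dunkl_map additive_c c_scale refl_coeff_c_other) auto

text \<open>\<sigma> carries the summand of \<open>k\<close> to that of its image, so covariance is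
  a reindexing of the sum.\<close>

lemma w_op_dunkl: "w_op \<sigma> (dunkl i v) = dunkl (Perm.apply \<sigma> i) (w_op \<sigma> v)"
proof -
  have term_eq: "Poly_Mapping.map (refl_coeff (Perm.apply \<sigma> k) (Perm.apply \<sigma> i))
      (ddiff (Perm.apply \<sigma> i) (Perm.apply \<sigma> k) (w_op \<sigma> v))
    = w_op \<sigma> (Poly_Mapping.map (refl_coeff k i) (ddiff i k v))" if "k \<noteq> i" for k
    using that
    by (simp add: w_op_def ddiff_map additive_w apply_inj ddiff_perm_vars map_perm_vars additive_refl_coeff
        map_map_additive refl_coeff_w)
  have "bij_betw (Perm.apply \<sigma>) (UNIV - {i}) (UNIV - {Perm.apply \<sigma> i})"
    using bij_betw_DiffI[of "Perm.apply \<sigma>" UNIV UNIV "{i}" "{Perm.apply \<sigma> i}"] by simp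
  from sum.reindex_bij_betw[OF this, of "\<lambda>k. Poly_Mapping.map (refl_coeff k (Perm.apply \<sigma> i))
      (ddiff (Perm.apply \<sigma> i) k (w_op \<sigma> v))"]
  have "dunkl (Perm.apply \<sigma> i) (w_op \<sigma> v)
    = smul u (\<Sum>k\<in>UNIV - {i}. w_op \<sigma> (Poly_Mapping.map (refl_coeff k i) (ddiff i k v)))"
    by (simp add: dunkl_def term_eq)
  also have "\<dots> = w_op \<sigma> (dunkl i v)"
    by (simp add: dunkl_def w_op_smul additive.sum[OF additive_w_op])
  finally show ?thesis by simp
qed

lemma dunkl_w_op_swap:
  "dunkl j (w_op (Perm.swap k i) v) = w_op (Perm.swap k i) (dunkl (Perm.apply (Perm.swap k i) j) v)"
  by (simp add: w_op_dunkl apply_swap)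

text \<open>A Dunkl operator with index \<open>i\<close> or \<open>k\<close> anticommutes with
  exactly one factor of \<open>c k c i\<close>. The resulting \<open>1 - c k c i\<close> is
  \<open>1 + c i c k\<close>, so the two indices of the reflection trade places while
  \<open>s\<close> exchanges \<open>x i\<close> and \<open>x k\<close>. For a third index no sign
  arises.\<close>

lemma dunkl_refl_op:
  assumes "k \<noteq> i"
  shows "dunkl i (refl_op k i v) = refl_op i k (dunkl k v)"
    and "dunkl k (refl_op k i v) = refl_op i k (dunkl i v)"
    and "j \<noteq> i \<Longrightarrow> j \<noteq> k \<Longrightarrow> dunkl j (refl_op k i v) = refl_op k i (dunkl j v)"
  using assms c_op_anticommute[of k i]
  by (simp_all add: refl_op_eq dunkl_add dunkl_c_op_same dunkl_c_op_other dunkl_w_op_swap apply_swap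
      additive.minus[OF additive_c_op] additive.diff[OF additive_dunkl] swap_sym[of i k])

text \<open>The commutator of two Dunkl operators commutes with all variables, by the Jacobi identity and the
  covariance of the Dunkl operators, and kills constants; hence it vanishes.\<close>

lemma dunkl_commutator_shift_other:
  assumes "l \<noteq> i" "l \<noteq> j" "i \<noteq> j"
  shows "dunkl i (dunkl j (shift l v)) - dunkl j (dunkl i (shift l v))
    = shift l (dunkl i (dunkl j v) - dunkl j (dunkl i v))"
  using assms
  by (simp add: dunkl_shift dunkl_add additive.diff[OF additive_dunkl] dunkl_smul
      dunkl_refl_op(3) additive.diff[OF additive_shift])

text \<open>Write \<open>D\<close> for the Dunkl operators and \<open>R k i\<close> for
  \<open>refl_op k i\<close>. In the sum over \<open>k\<close>, the terms other than
  \<open>k = j\<close> satisfy \<open>D j R k i = R k i D j\<close> and cancel. The leftovers cancel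
  by \<open>D j R j i = R i j D i\<close> and \<open>D i R i j = R j i D j\<close>, which is why the
  term \<open>k = j\<close> is split off.\<close>

lemma dunkl_commutator_shift_same:
  assumes "i \<noteq> j"
  shows "dunkl i (dunkl j (shift i v)) - dunkl j (dunkl i (shift i v))
    = shift i (dunkl i (dunkl j v) - dunkl j (dunkl i v))"
proof -
  have "dunkl j (\<Sum>k\<in>UNIV - {i}. refl_op k i v) = (\<Sum>k\<in>UNIV - {i}. dunkl j (refl_op k i v))"
    by (rule additive.sum[OF additive_dunkl])
  also have "\<dots> = dunkl j (refl_op j i v) + (\<Sum>k\<in>UNIV - {i} - {j}. dunkl j (refl_op k i v))"
    using assms by (intro sum.remove) auto
  also have "dunkl j (refl_op j i v) = refl_op i j (dunkl i v)"
    using assms by (simp add: dunkl_refl_op)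
  also have "(\<Sum>k\<in>UNIV - {i} - {j}. dunkl j (refl_op k i v)) = (\<Sum>k\<in>UNIV - {i} - {j}. refl_op k i (dunkl j v))"
    using assms by (intro sum.cong) (auto simp: dunkl_refl_op)
  also have "\<dots> = (\<Sum>k\<in>UNIV - {i}. refl_op k i (dunkl j v)) - refl_op j i (dunkl j v)"
    using assms by (subst sum.remove[of "UNIV - {i}" j]) auto
  finally show ?thesis
    using assms
    by (simp add: dunkl_shift dunkl_add additive.diff[OF additive_dunkl] dunkl_smul
        dunkl_refl_op additive.diff[OF additive_shift] additive.add[OF additive_smul]
        additive.diff[OF additive_smul])
qed

lemma dunkl_commute: "dunkl i (dunkl j v) = dunkl j (dunkl i v)"
proof (cases "i = j")
  case False
  define E where "E v = dunkl i (dunkl j v) - dunkl j (dunkl i v)" for v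
  have E_shift: "E (shift l v) = shift l (E v)" for l v
  proof (cases "l = j")
    case True
    \<comment> \<open>The commutator is antisymmetric, so \<open>l = j\<close> is the case
      \<open>l = i\<close> with the two indices exchanged.\<close>
    have "dunkl j (dunkl i (shift j v)) - dunkl i (dunkl j (shift j v))
      = shift j (dunkl j (dunkl i v) - dunkl i (dunkl j v))"
      using False by (intro dunkl_commutator_shift_same) simp
    then have "- E (shift j v) = shift j (- E v)"
      by (simp add: E_def)
    then show ?thesis
      by (simp add: True additive.minus[OF additive_shift])
  qed (use False dunkl_commutator_shift_same dunkl_commutator_shift_other in \<open>unfold E_def, metis\<close>)
  have E_add: "E (v + v') = E v + E v'" for v v'
    by (simp add: E_def dunkl_add)
  have "E v = 0"
  proof (induction v rule: poly_mapping_single_induct)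
    case (single \<alpha> m)
    show ?case
    proof (induction \<alpha> rule: exponent_induct)
      case zero
      show ?case by (simp add: E_def additive.zero[OF additive_dunkl])
    next
      case (add_single \<alpha> j)
      then show ?case
        by (simp only: E_shift additive.zero[OF additive_shift] flip: shift_single)
    qed
  qed (simp add: E_add)
  then show ?thesis by (simp add: E_def)
qed simp

section \<open>The representation of the Hecke-Clifford algebra\<close>

primrec gen_op :: "'n gen \<Rightarrow> ('n, 'm) ypoly_tensor \<Rightarrow> ('n, 'm) ypoly_tensor" where
  "gen_op (GX i) = dunkl i"
| "gen_op (GY i) = shift i"
| "gen_op (GC i) = c_op i"
| "gen_op (GW \<sigma>) = w_op \<sigma>"

sublocale rep: free_rep smul gen_op
proof
  fix a b x v v'
  show "smul a (v + v') = smul a v + smul a v'"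
    by (rule additive.add[OF additive_smul])
  show "smul (a + b) v = smul a v + smul b v"
    by (intro poly_mapping_eqI)
      (simp add: poly_tensor_scale_def lookup_map lookup_add scale_left_distrib)
  show "smul a (smul b v) = smul (a * b) v"
    by (rule smul_smul)
  show "smul 1 v = v"
    by (intro poly_mapping_eqI) (simp add: poly_tensor_scale_def lookup_map)
  show "gen_op x (v + v') = gen_op x v + gen_op x v'"
    by (cases x) (simp_all add: dunkl_add shift_add c_op_add w_op_add)
  show "gen_op x (smul a v) = smul a (gen_op x v)"
    by (cases x) (simp_all add: dunkl_smul shift_smul c_op_smul w_op_smul)
qed

lemma act_generators [simp]:
  "rep.act (gx i) v = dunkl i v" "rep.act (gy i) v = shift i v"
  "rep.act (gc i) v = c_op i v" "rep.act (gw \<sigma>) v = w_op \<sigma> v"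
  "rep.act (gs i j) v = w_op (Perm.swap i j) v" "rep.act (sc a) v = smul a v"
  by (simp_all add: gx_def gy_def gc_def gw_def gs_def sc_def word_op_def zero_word_def rep.act_generator rep.act_single)

lemma w_op_inverse: "w_op \<sigma> (w_op (inverse \<sigma>) v) = v"
  by (simp add: w_op_one flip: w_op_mult)

lemma act_relators:
  assumes "a \<in> H_relators u"
  shows "rep.act a v = 0"
  using assms c_op_anticommute[THEN eq_neg_iff_add_eq_0[THEN iffD1]]
  unfolding H_relators_def K_relators_def
  by (auto simp: rep.act_minus rep.act_add rep.act_mult rep.act_sum w_op_one w_op_mult c_op_square
      w_op_c_op w_op_inverse dunkl_commute shift_commute c_op_shift dunkl_c_op_same dunkl_c_op_other
      w_op_dunkl w_op_shift dunkl_shift refl_op_eq)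

end

section \<open>The algebra as a quotient of the free algebra\<close>

lemma free_ring_simps [simp]:
  "carrier free_ring = UNIV" "a \<otimes>\<^bsub>free_ring\<^esub> b = a * b" "a \<oplus>\<^bsub>free_ring\<^esub> b = a + b"
  "\<one>\<^bsub>free_ring\<^esub> = 1" "\<zero>\<^bsub>free_ring\<^esub> = 0"
  by (simp_all add: free_ring_def)

lemma ring_free_ring: "ring free_ring"
proof (rule ringI)
  show "abelian_group free_ring"
    by (rule abelian_groupI) (auto simp: algebra_simps intro: exI[of _ "- _"])
  show "Group.monoid free_ring"
    by (rule monoidI) (auto simp: mult.assoc)
qed (auto simp: algebra_simps)

interpretation free: ring free_ring
  by (rule ring_free_ring)

lemma free_ring_a_inv [simp]: "\<ominus>\<^bsub>free_ring\<^esub> a = - a"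
  by (rule free.minus_equality) auto

lemma free_ring_a_minus [simp]: "a \<ominus>\<^bsub>free_ring\<^esub> b = a - b"
  by (simp add: a_minus_def)

lemma ideal_H_ideal: "ideal (H_ideal u) free_ring"
  unfolding H_ideal_def by (rule free.genideal_ideal) simp

lemma ring_H_alg: "ring (H_alg u)"
  unfolding H_alg_def by (rule ideal.quotient_is_ring[OF ideal_H_ideal])

lemma H_class_hom: "ring_hom_ring free_ring (H_alg u) (H_class u)"
  unfolding H_alg_def H_class_def[abs_def] by (rule ideal.rcos_ring_hom_ring[OF ideal_H_ideal])

lemma H_class_add: "H_class u (a + b) = H_class u a \<oplus>\<^bsub>H_alg u\<^esub> H_class u b"
  using ring_hom_add[OF ring_hom_ring.homh[OF H_class_hom], of a b] by simp

lemma H_class_mult: "H_class u (a * b) = H_class u a \<otimes>\<^bsub>H_alg u\<^esub> H_class u b"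
  using ring_hom_mult[OF ring_hom_ring.homh[OF H_class_hom], of a b] by simp

lemma H_class_one: "\<one>\<^bsub>H_alg u\<^esub> = H_class u 1"
  by (simp add: ring_hom_one[OF ring_hom_ring.homh[OF H_class_hom], simplified])

lemma H_class_carrier [simp]: "H_class u a \<in> carrier (H_alg u)"
  using ring_hom_closed[OF ring_hom_ring.homh[OF H_class_hom]] by simp

lemma carrier_H_alg: "carrier (H_alg u) = Set.range (H_class u)"
  unfolding H_alg_def H_class_def by (auto simp: FactRing_def A_RCOSETS_def RCOSETS_def a_r_coset_def)

lemma H_class_zero: "\<zero>\<^bsub>H_alg u\<^esub> = H_class u (0 :: 'n::finite gen free_alg)"
proof -
  interpret ring_hom_ring free_ring "H_alg u :: 'n gen free_alg set ring" "H_class u" by (rule H_class_hom)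
  show ?thesis using hom_zero by simp
qed

lemma H_class_uminus:
  fixes a :: "'n::finite gen free_alg"
  shows "\<ominus>\<^bsub>H_alg u\<^esub> H_class u a = H_class u (- a)"
proof -
  interpret ring "H_alg u :: 'n gen free_alg set ring" by (rule ring_H_alg)
  show ?thesis
    by (rule minus_equality) (simp_all add: H_class_zero flip: H_class_add)
qed

lemma H_class_eq_iff: "H_class u a = H_class u b \<longleftrightarrow> a - b \<in> H_ideal u"
  using free.quotient_eq_iff_same_a_r_cos[OF ideal_H_ideal, of a b u] by (simp add: H_class_def)

lemma H_class_relator: "a - b \<in> H_relators u \<Longrightarrow> H_class u a = H_class u b"
  unfolding H_class_eq_iff H_ideal_def using free.genideal_self[of "H_relators u"] by auto

lemma H_class_mult_cong:
  "H_class u a = H_class u a' \<Longrightarrow> H_class u b = H_class u b' \<Longrightarrow> H_class u (a * b) = H_class u (a' * b')"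
  by (simp add: H_class_mult)

section \<open>Spanning by ordered words\<close>

definition yword :: "'n list \<Rightarrow> 'n gen free_alg"
  where "yword l = Poly_Mapping.single (Word (map GY l)) 1"

lemma yword_Nil [simp]: "yword [] = 1"
  unfolding yword_def by (metis list.simps(8) single_one zero_word_def)

lemma yword_Cons: "yword (j # l) = gy j * yword l"
  by (simp add: yword_def gy_def mult_single plus_word_def)

text \<open>Representatives in the free algebra of the products of \<open>y\<close> words with
  elements of \<open>Hx u\<close>, and their sums. Generators of \<open>Hx u\<close> enter only from
  the right, since in the tensor product a right factor can be moved over to
  \<open>M\<close>.\<close>

inductive_set yspan :: "complex \<Rightarrow> 'n::finite gen free_alg set" for u where
  yword: "yword l \<in> yspan u"
| add: "a \<in> yspan u \<Longrightarrow> b \<in> yspan u \<Longrightarrow> a + b \<in> yspan u"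
| right_sc: "a \<in> yspan u \<Longrightarrow> a * sc k \<in> yspan u"
| right_gc: "a \<in> yspan u \<Longrightarrow> a * gc i \<in> yspan u"
| right_gw: "a \<in> yspan u \<Longrightarrow> a * gw \<sigma> \<in> yspan u"
| right_gx: "a \<in> yspan u \<Longrightarrow> a * gx i \<in> yspan u"
| cong: "a \<in> yspan u \<Longrightarrow> H_class u a = H_class u b \<Longrightarrow> b \<in> yspan u"

text \<open>Left multiplication commutes with all the right-hand closure rules, so only
  \<open>y\<close> words have to be tested.\<close>

lemma yspan_left:
  assumes "a \<in> yspan u" and "\<And>l. b * yword l \<in> yspan u"
  shows "b * a \<in> yspan u"
  using assms(1)
proof induction
  case (add a a')
  then show ?case
    by (simp add: distrib_left yspan.add)
next
  case (cong a a')
  show ?case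
    by (rule yspan.cong[OF cong.IH H_class_mult_cong[OF refl cong.hyps(2)]])
qed (simp_all add: assms(2) yspan.right_sc yspan.right_gc yspan.right_gw yspan.right_gx flip: mult.assoc)

lemma sc_commute: "sc k * a = a * sc k"
  by (induction a rule: poly_mapping_single_induct)
    (simp_all add: sc_def mult_single distrib_left distrib_right mult.commute)

lemma H_class_gy_commute: "H_class u (gy i * gy j) = H_class u (gy j * gy i)"
  by (rule H_class_relator) (auto simp: H_relators_def)

lemma H_class_gy_gc: "H_class u (gc j * gy i) = H_class u (gy i * gc j)"
  by (rule H_class_relator[symmetric]) (auto simp: H_relators_def)

lemma gw_mult_relator: "gw \<sigma> * gw \<tau> - gw (\<sigma> * \<tau>) \<in> H_relators u"
  unfolding H_relators_def K_relators_def by auto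

lemma gw_gy_relator: "gw \<sigma> * gy i * gw (inverse \<sigma>) - gy (Perm.apply \<sigma> i) \<in> H_relators u"
  unfolding H_relators_def by auto

lemma H_class_gw_inverse: "H_class u (gw (inverse \<sigma>) * gw \<sigma>) = H_class u 1"
proof -
  have "H_class u (gw (inverse \<sigma>) * gw \<sigma>) = H_class u (gw (inverse \<sigma> * \<sigma>))"
    by (rule H_class_relator[OF gw_mult_relator])
  also have "\<dots> = H_class u 1"
    unfolding left_inverse by (rule H_class_relator) (simp add: H_relators_def K_relators_def)
  finally show ?thesis .
qed

lemma H_class_gw_gy: "H_class u (gw \<sigma> * gy i) = H_class u (gy (Perm.apply \<sigma> i) * gw \<sigma>)"
proof -
  have "H_class u (gw \<sigma> * gy i * gw (inverse \<sigma>)) = H_class u (gy (Perm.apply \<sigma> i))"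
    by (rule H_class_relator[OF gw_gy_relator])
  then have "H_class u (gw \<sigma> * gy i * gw (inverse \<sigma>) * gw \<sigma>) = H_class u (gy (Perm.apply \<sigma> i) * gw \<sigma>)"
    by (rule H_class_mult_cong) simp
  moreover have "H_class u (gw \<sigma> * gy i * gw (inverse \<sigma>) * gw \<sigma>) = H_class u (gw \<sigma> * gy i * 1)"
    unfolding mult.assoc[of _ "gw (inverse \<sigma>)"]
    by (rule H_class_mult_cong) (simp_all add: H_class_gw_inverse)
  ultimately show ?thesis by simp
qed

text \<open>The minus sign is written as the scalar -1 because \<open>yspan\<close> is built with
  sums and scalars.\<close>

lemma H_class_gx_gy_other:
  assumes "i \<noteq> j"
  shows "H_class u (gx i * gy j)
    = H_class u (gy j * gx i + sc (- 1) * (sc u * ((1 + gc j * gc i) * gs j i)))"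
proof (rule H_class_relator[symmetric])
  have "sc (- 1) * a = - a" for a :: "'a gen free_alg"
    by (simp add: sc_def single_uminus)
  then show "gy j * gx i + sc (- 1) * (sc u * ((1 + gc j * gc i) * gs j i)) - gx i * gy j \<in> H_relators u"
    using assms by (auto simp: H_relators_def algebra_simps)
qed

lemma H_class_gx_gy_same:
  "H_class u (gx i * gy i)
    = H_class u (gy i * gx i + sc u * (\<Sum>k\<in>UNIV - {i}. (1 + gc k * gc i) * gs k i))"
  by (rule H_class_relator[symmetric]) (auto simp: H_relators_def algebra_simps)

lemma yspan_gy: "a \<in> yspan u \<Longrightarrow> gy j * a \<in> yspan u"
  by (erule yspan_left) (simp add: yspan.yword flip: yword_Cons)

lemma yspan_sc: "a \<in> yspan u \<Longrightarrow> sc k * a \<in> yspan u"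
  by (simp add: sc_commute yspan.right_sc)

lemma yspan_gc:
  assumes "a \<in> yspan u"
  shows "gc j * a \<in> yspan u"
  using assms
proof (rule yspan_left)
  fix l
  have "H_class u (yword l * gc j) = H_class u (gc j * yword l)"
  proof (induction l)
    case (Cons i l)
    have "H_class u (gc j * gy i * yword l) = H_class u (gy i * gc j * yword l)"
      by (rule H_class_mult_cong) (simp_all add: H_class_gy_gc)
    moreover have "H_class u (gy i * (yword l * gc j)) = H_class u (gy i * (gc j * yword l))"
      by (rule H_class_mult_cong) (simp_all add: Cons)
    ultimately show ?case by (simp add: yword_Cons mult.assoc)
  qed simp
  then show "gc j * yword l \<in> yspan u"
    by (rule yspan.cong[OF yspan.right_gc[OF yspan.yword]])
qed

lemma yspan_gw:
  assumes "a \<in> yspan u"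
  shows "gw \<sigma> * a \<in> yspan u"
  using assms
proof (rule yspan_left)
  fix l
  have "H_class u (yword (map (Perm.apply \<sigma>) l) * gw \<sigma>) = H_class u (gw \<sigma> * yword l)"
  proof (induction l)
    case (Cons i l)
    have "H_class u (gw \<sigma> * gy i * yword l) = H_class u (gy (Perm.apply \<sigma> i) * gw \<sigma> * yword l)"
      by (rule H_class_mult_cong) (simp_all add: H_class_gw_gy)
    moreover have "H_class u (gy (Perm.apply \<sigma> i) * (yword (map (Perm.apply \<sigma>) l) * gw \<sigma>))
      = H_class u (gy (Perm.apply \<sigma> i) * (gw \<sigma> * yword l))"
      by (rule H_class_mult_cong) (simp_all add: Cons)
    ultimately show ?case by (simp add: yword_Cons mult.assoc)
  qed simp
  then show "gw \<sigma> * yword l \<in> yspan u"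
    by (rule yspan.cong[OF yspan.right_gw[OF yspan.yword]])
qed

lemma yspan_zero: "0 \<in> yspan u"
  using yspan.right_sc[OF yspan.yword, of "[]" 0] by (simp add: sc_def)

lemma yspan_sum: "(\<And>k. k \<in> A \<Longrightarrow> a k \<in> yspan u) \<Longrightarrow> (\<Sum>k\<in>A. a k) \<in> yspan u"
  by (induction A rule: infinite_finite_induct) (auto intro: yspan_zero yspan.add)

text \<open>Moving \<open>x i\<close> past one \<open>y j\<close> leaves \<open>x i\<close> before a
  shorter word, plus terms with only Clifford and group elements before that word; the latter are
  handled by \<open>yspan_gc\<close> and \<open>yspan_gw\<close>.\<close>

lemma yspan_gx:
  assumes "a \<in> yspan u"
  shows "gx i * a \<in> yspan u"
  using assms
proof (rule yspan_left)
  fix l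
  show "gx i * yword l \<in> yspan u"
  proof (induction l)
    case Nil
    show ?case
      using yspan.right_gx[OF yspan.yword, of "[]"] by simp
  next
    case (Cons j l)
    have R: "(1 + gc k * gc i) * gs k i * yword l \<in> yspan u" for k
      unfolding gs_def distrib_right mult.assoc mult_1_left
      by (intro yspan.add yspan_gc yspan_gw yspan.yword)
    have gy: "gy j * gx i * yword l \<in> yspan u"
      unfolding mult.assoc by (rule yspan_gy[OF Cons])
    show ?case
    proof (cases "j = i")
      case True
      have "H_class u ((gy i * gx i + sc u * (\<Sum>k\<in>UNIV - {i}. (1 + gc k * gc i) * gs k i)) * yword l)
        = H_class u (gx i * gy i * yword l)"
        by (rule H_class_mult_cong) (simp_all add: H_class_gx_gy_same)
      moreover have "(gy i * gx i + sc u * (\<Sum>k\<in>UNIV - {i}. (1 + gc k * gc i) * gs k i)) * yword l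
        \<in> yspan u"
        unfolding distrib_right[of _ _ "yword l"] mult.assoc[of "sc u"] sum_distrib_right
        using gy True by (intro yspan.add yspan_sc yspan_sum R) simp
      ultimately show ?thesis
        using True by (auto simp: yword_Cons mult.assoc intro: yspan.cong)
    next
      case False
      then have "H_class u ((gy j * gx i + sc (- 1) * (sc u * ((1 + gc j * gc i) * gs j i))) * yword l)
        = H_class u (gx i * gy j * yword l)"
        by (intro H_class_mult_cong) (simp_all add: H_class_gx_gy_other)
      moreover have "(gy j * gx i + sc (- 1) * (sc u * ((1 + gc j * gc i) * gs j i))) * yword l
        \<in> yspan u"
        unfolding distrib_right[of _ _ "yword l"] mult.assoc[of "sc _"]
        using gy by (intro yspan.add yspan_sc R)
      ultimately show ?thesis
        by (auto simp: yword_Cons mult.assoc intro: yspan.cong)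
    qed
  qed
qed

text \<open>This is the spanning half of a triangular decomposition: the set contains 1 and is
  closed under left multiplication by every generator.\<close>

lemma yspan_UNIV: "a \<in> yspan u"
proof (induction a rule: poly_mapping_single_induct)
  case (single x k)
  have word: "Poly_Mapping.single (Word gs) 1 \<in> yspan u" for gs
  proof (induction gs)
    case Nil
    show ?case
      using yspan.yword[of "[]"] by (simp add: yword_def)
  next
    case (Cons g gs)
    have "Poly_Mapping.single (Word (g # gs)) (1 :: complex)
      = Poly_Mapping.single (Word [g]) 1 * Poly_Mapping.single (Word gs) 1"
      by (simp add: mult_single plus_word_def)
    then show ?case
      using yspan_gx[OF Cons] yspan_gy[OF Cons] yspan_gc[OF Cons] yspan_gw[OF Cons]
      by (cases g) (simp_all add: gx_def gy_def gc_def gw_def)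
  qed
  have "Poly_Mapping.single x k = sc k * Poly_Mapping.single x 1"
    by (simp add: sc_def mult_single)
  then show ?case
    using yspan_sc[OF word, of k "letters x"] by simp
qed (rule yspan.add)

lemma H_class_yword_remove1:
  "j \<in> set l \<Longrightarrow> H_class u (yword l) = H_class u (gy j * yword (remove1 j l))"
proof (induction l)
  case (Cons i l)
  show ?case
  proof (cases "i = j")
    case False
    have "H_class u (gy i * yword l) = H_class u (gy i * (gy j * yword (remove1 j l)))"
      using Cons False by (intro H_class_mult_cong) auto
    also have "\<dots> = H_class u (gy j * (gy i * yword (remove1 j l)))"
      unfolding mult.assoc[symmetric] by (rule H_class_mult_cong) (simp_all add: H_class_gy_commute)
    finally show ?thesis using False by (simp add: yword_Cons)
  qed (simp add: yword_Cons)
qed simp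

text \<open>The list chosen inside \<open>y_monomial\<close> is determined only up to order.\<close>

lemma H_class_yword_cong: "mset l = mset l' \<Longrightarrow> H_class u (yword l) = H_class u (yword l')"
proof (induction l arbitrary: l')
  case (Cons j l)
  have "j \<in> set l'"
    using mset_eq_setD[OF Cons.prems] by auto
  moreover have "mset l = mset (remove1 j l')"
    using Cons.prems by (simp flip: Cons.prems)
  ultimately show ?case
    using Cons.IH[of "remove1 j l'"] H_class_yword_remove1[of j l' u]
    by (metis H_class_mult yword_Cons)
qed simp

lemma ex_list_count:
  fixes \<alpha> :: "'n \<Rightarrow>\<^sub>0 nat"
  shows "\<exists>l. \<forall>i. count_list l i = Poly_Mapping.lookup \<alpha> i"
proof (induction \<alpha> rule: exponent_induct)
  case (add_single \<alpha> j)
  then obtain l where "\<forall>i. count_list l i = Poly_Mapping.lookup \<alpha> i" by blast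
  then show ?case
    by (intro exI[of _ "j # l"]) (auto simp: lookup_add lookup_single when_def)
qed (auto intro: exI[of _ "[]"])

lemma y_monomial_eq:
  assumes "\<And>i. count_list l i = Poly_Mapping.lookup \<alpha> i"
  shows "y_monomial u \<alpha> = H_class u (yword l)"
proof -
  define l' where "l' = (SOME l. \<forall>i. count_list l i = Poly_Mapping.lookup \<alpha> i)"
  have "\<forall>i. count_list l' i = Poly_Mapping.lookup \<alpha> i"
    unfolding l'_def by (rule someI_ex[OF ex_list_count])
  then have "mset l' = mset l"
    using assms by (intro multiset_eqI) (simp flip: count_mset)
  then show ?thesis
    using H_class_yword_cong[of l' l u] by (simp add: y_monomial_def yword_def l'_def)
qed

section \<open>Tensor products\<close>

locale ring_tensor = ring S
  for S :: "('r, 'z) ring_scheme" (structure) +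
  fixes D :: "'r set" and act :: "'r \<Rightarrow> 'm::ab_group_add \<Rightarrow> 'm"
  assumes D_closed: "D \<subseteq> carrier S"
begin

abbreviation "N \<equiv> tensor_kernel S D act"
abbreviation "cls \<equiv> tensor_class S D act"

lemma frag_diff_in_pairs_group:
  assumes "r \<in> carrier S" "r' \<in> carrier S" "r'' \<in> carrier S"
  shows "frag_of (r, m) - frag_of (r', m') - frag_of (r'', m'') \<in> carrier (pairs_group S)"
    and "frag_of (r, m) - frag_of (r', m') \<in> carrier (pairs_group S)"
  using keys_diff[of "frag_of (r, m) - frag_of (r', m')" "frag_of (r'', m'')"]
    keys_diff[of "frag_of (r, m)" "frag_of (r', m')"] assms
  by (auto simp: pairs_group_def)

lemma subgroup_N: "subgroup N (pairs_group S)"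
proof -
  have "group (pairs_group S :: ('r \<times> 'm \<Rightarrow>\<^sub>0 int) monoid)"
    by (simp add: pairs_group_def)
  then show ?thesis
    unfolding tensor_kernel_def using D_closed
    by (intro group.generate_is_subgroup) (auto intro!: frag_diff_in_pairs_group)
qed

lemma N_zero: "0 \<in> N"
  using subgroup.one_closed[OF subgroup_N] by (simp add: pairs_group_def)

lemma N_add: "s \<in> N \<Longrightarrow> t \<in> N \<Longrightarrow> s + t \<in> N"
  using subgroup.m_closed[OF subgroup_N] by (simp add: pairs_group_def)

lemma N_minus: "t \<in> N \<Longrightarrow> - t \<in> N"
  using subgroup.m_inv_closed[OF subgroup_N, of t] subgroup.subset[OF subgroup_N]
  by (auto simp: pairs_group_def)

lemma N_add_left: "r \<in> carrier S \<Longrightarrow> r' \<in> carrier S \<Longrightarrow>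
    frag_of (r \<oplus> r', m) - frag_of (r, m) - frag_of (r', m) \<in> N"
  unfolding tensor_kernel_def by (rule generate.incl) blast

lemma N_add_right: "r \<in> carrier S \<Longrightarrow>
    frag_of (r, m + m') - frag_of (r, m) - frag_of (r, m') \<in> N"
  unfolding tensor_kernel_def by (rule generate.incl) blast

lemma N_balanced: "r \<in> carrier S \<Longrightarrow> b \<in> D \<Longrightarrow> frag_of (r \<otimes> b, m) - frag_of (r, act b m) \<in> N"
  unfolding tensor_kernel_def by (rule generate.incl) blast

lemma N_induct [consumes 1, case_names zero add minus add_left add_right balanced]:
  assumes "t \<in> N" and "P 0"
    and "\<And>s t. P s \<Longrightarrow> P t \<Longrightarrow> P (s + t)" and "\<And>t. P t \<Longrightarrow> P (- t)"
    and "\<And>r r' m. r \<in> carrier S \<Longrightarrow> r' \<in> carrier S \<Longrightarrow>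
      P (frag_of (r \<oplus> r', m) - frag_of (r, m) - frag_of (r', m))"
    and "\<And>r m m'. r \<in> carrier S \<Longrightarrow> P (frag_of (r, m + m') - frag_of (r, m) - frag_of (r, m'))"
    and "\<And>r b m. r \<in> carrier S \<Longrightarrow> b \<in> D \<Longrightarrow> P (frag_of (r \<otimes> b, m) - frag_of (r, act b m))"
  shows "P t"
  using assms(1) unfolding tensor_kernel_def
proof (induction rule: generate.induct)
  case one
  then show ?case by (simp add: pairs_group_def assms)
next
  case (incl h)
  then show ?case
    by (elim UnE CollectE exE conjE; simp only: assms(5-7))
next
  case (inv h)
  then have "P h"
    by (elim UnE CollectE exE conjE; simp only: assms(5-7))
  \<comment> \<open>On the carrier the group inverse can be rewritten as unary minus.\<close>
  have "h \<in> carrier (pairs_group S)"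
    using inv D_closed by (auto intro!: frag_diff_in_pairs_group)
  then show ?case
    using assms(4)[OF \<open>P h\<close>] by (simp add: pairs_group_def)
next
  case (eng h1 h2)
  then show ?case by (simp add: pairs_group_def assms)
qed

text \<open>Valid for every \<open>t\<close>, inside the carrier or not, so the congruence rules
  below carry no side conditions on their arguments.\<close>

lemma cls_eq: "cls t = (\<lambda>n. n + t) ` N"
  by (auto simp: tensor_class_def r_coset_def pairs_group_def)

lemma cls_eq_iff: "cls t = cls t' \<longleftrightarrow> t - t' \<in> N"
proof
  assume "cls t = cls t'"
  moreover have "t \<in> cls t"
    using N_zero by (force simp: cls_eq)
  ultimately show "t - t' \<in> N"
    by (auto simp: cls_eq)
next
  assume t: "t - t' \<in> N"
  have "n + t \<in> (\<lambda>n. n + t') ` N" if "n \<in> N" for n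
    using N_add[OF that t] by (intro image_eqI[of _ _ "n + (t - t')"]) auto
  moreover have "n + t' \<in> (\<lambda>n. n + t) ` N" if "n \<in> N" for n
    using N_add[OF that N_minus[OF t]] by (intro image_eqI[of _ _ "n + - (t - t')"]) auto
  ultimately show "cls t = cls t'"
    unfolding cls_eq by blast
qed

lemma cls_add_cong:
  assumes "cls t = cls t'" "cls s = cls s'"
  shows "cls (t + s) = cls (t' + s')"
  using N_add[of "t - t'" "s - s'"] assms by (simp add: cls_eq_iff algebra_simps)

lemma cls_sum_cong:
  "(\<And>k. k \<in> A \<Longrightarrow> cls (t k) = cls (t' k)) \<Longrightarrow> cls (\<Sum>k\<in>A. t k) = cls (\<Sum>k\<in>A. t' k)"
proof (induction A rule: infinite_finite_induct)
  case (insert k A)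
  have "cls (t k + sum t A) = cls (t' k + sum t' A)"
    by (intro cls_add_cong insert) auto
  then show ?case using insert by simp
qed auto

lemma cls_add_left: "r \<in> carrier S \<Longrightarrow> r' \<in> carrier S \<Longrightarrow>
    cls (frag_of (r \<oplus> r', m)) = cls (frag_of (r, m) + frag_of (r', m))"
  using N_add_left by (simp add: cls_eq_iff algebra_simps)

lemma cls_add_right: "r \<in> carrier S \<Longrightarrow>
    cls (frag_of (r, m + m')) = cls (frag_of (r, m) + frag_of (r, m'))"
  using N_add_right by (simp add: cls_eq_iff algebra_simps)

lemma cls_balanced: "r \<in> carrier S \<Longrightarrow> b \<in> D \<Longrightarrow>
    cls (frag_of (r \<otimes> b, m)) = cls (frag_of (r, act b m))"
  using N_balanced by (simp add: cls_eq_iff)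

text \<open>Additivity applied to \<open>0 + 0\<close> puts \<open>- frag_of (r, 0)\<close> into the
  kernel.\<close>

lemma cls_zero: "r \<in> carrier S \<Longrightarrow> cls (frag_of (r, 0)) = cls 0"
  using N_minus[OF N_add_right[of r 0 0]] by (simp add: cls_eq_iff)

lemma left_mult_N:
  assumes "r \<in> carrier S" "t \<in> N"
  shows "frag_extend (\<lambda>(r', m). frag_of (r \<otimes> r', m)) t \<in> N"
  using assms(2)
proof (induction rule: N_induct)
  case (add_left r1 r2 m)
  then show ?case
    using N_add_left[of "r \<otimes> r1" "r \<otimes> r2" m] assms(1) by (simp add: frag_extend_diff r_distr)
next
  case (add_right r1 m m')
  then show ?case
    using N_add_right[of "r \<otimes> r1" m m'] assms(1) by (simp add: frag_extend_diff)
next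
  case (balanced r1 b m)
  then show ?case
    using N_balanced[of "r \<otimes> r1" b m] assms(1) D_closed by (simp add: frag_extend_diff m_assoc subset_iff)
qed (simp_all add: N_zero N_add N_minus frag_extend_add frag_extend_minus)

text \<open>The union over representatives collapses: by \<open>left_mult_N\<close> all of them
  yield the same coset.\<close>

lemma tensor_left_action_cls:
  assumes "r \<in> carrier S"
  shows "tensor_left_action S D act r (cls t) = cls (frag_extend (\<lambda>(r', m). frag_of (r \<otimes> r', m)) t)"
proof -
  have "cls (frag_extend (\<lambda>(r', m). frag_of (r \<otimes> r', m)) t')
    = cls (frag_extend (\<lambda>(r', m). frag_of (r \<otimes> r', m)) t)" if "t' \<in> cls t" for t'
  proof -
    have "t' - t \<in> N"
      using that by (auto simp: cls_eq)
    from left_mult_N[OF assms this] show ?thesis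
      by (simp add: cls_eq_iff frag_extend_diff)
  qed
  moreover have "t \<in> cls t"
    using N_zero by (force simp: cls_eq)
  ultimately show ?thesis
    unfolding tensor_left_action_def by blast
qed

end

section \<open>The induced module\<close>

context dunkl_module
begin

text \<open>The elements acting by zero form a two-sided ideal, and it contains the
  relators.\<close>

lemma act_H_ideal:
  assumes "a \<in> H_ideal u"
  shows "rep.act a v = 0"
proof -
  have "subgroup {a. \<forall>v. rep.act a v = 0} (add_monoid free_ring)"
  proof (rule group.subgroupI)
    show "group (add_monoid (free_ring :: 'n gen free_alg ring))"
      by (rule free.a_group)
    show "{a. \<forall>v. rep.act a v = 0} \<noteq> {}"
      using rep.act_zero by blast
    show "inv\<^bsub>add_monoid free_ring\<^esub> a \<in> {a. \<forall>v. rep.act a v = 0}"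
      if "a \<in> {a. \<forall>v. rep.act a v = 0}" for a
      using that unfolding free_ring_a_inv[unfolded a_inv_def] by (simp add: rep.act_uminus)
  qed (auto simp: rep.act_add)
  then have "ideal {a. \<forall>v. rep.act a v = 0} free_ring"
    by (rule idealI[OF ring_free_ring])
      (simp_all add: rep.act_mult additive.zero[OF rep.additive_act])
  then have "H_ideal u \<subseteq> {a. \<forall>v. rep.act a v = 0}"
    unfolding H_ideal_def by (rule free.genideal_minimal) (auto intro: act_relators)
  with assms show ?thesis by blast
qed

lemma act_cong: "H_class u a = H_class u b \<Longrightarrow> rep.act a v = rep.act b v"
  using act_H_ideal[of "a - b" v] by (simp add: H_class_eq_iff rep.act_minus)

definition hact :: "'n gen free_alg set \<Rightarrow> ('n, 'm) ypoly_tensor \<Rightarrow> ('n, 'm) ypoly_tensor"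
  where "hact h = rep.act (SOME a. H_class u a = h)"

lemma hact_H_class [simp]: "hact (H_class u a) v = rep.act a v"
  unfolding hact_def by (rule act_cong) (rule someI, rule refl)

lemma hact_vec_add: "hact h (v + v') = hact h v + hact h v'"
  by (simp add: hact_def rep.act_vec_add)

lemma hact_add:
  "h \<in> carrier (H_alg u) \<Longrightarrow> h' \<in> carrier (H_alg u) \<Longrightarrow>
    hact (h \<oplus>\<^bsub>H_alg u\<^esub> h') v = hact h v + hact h' v"
  by (auto simp: carrier_H_alg rep.act_add simp flip: H_class_add)

lemma hact_mult:
  "h \<in> carrier (H_alg u) \<Longrightarrow> h' \<in> carrier (H_alg u) \<Longrightarrow>
    hact (h \<otimes>\<^bsub>H_alg u\<^esub> h') v = hact h (hact h' v)"
  by (auto simp: carrier_H_alg rep.act_mult simp flip: H_class_mult)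

lemma Hx_carrier: "Hx u \<subseteq> carrier (H_alg u)"
  unfolding Hx_def by (rule ring.generate_ring_incl[OF ring_H_alg]) auto

lemma Hx_in_carrier [simp]: "h \<in> Hx u \<Longrightarrow> h \<in> carrier (H_alg u)"
  using Hx_carrier by blast

lemma Hx_generators [simp]:
  "H_class u (sc k) \<in> Hx u" "H_class u (gc i) \<in> Hx u" "H_class u (gw \<sigma>) \<in> Hx u" "H_class u (gx i) \<in> Hx u"
  unfolding Hx_def by (auto intro!: generate_ring.incl)

text \<open>Unit and negatives, which are separate cases in a generated ring, are absorbed by the
  scalars 1 and -1.\<close>

lemma Hx_induct [consumes 1, case_names sc gc gw gx add mult]:
  fixes P :: "'n gen free_alg set \<Rightarrow> bool"
  assumes "h \<in> Hx u"
    and sc: "\<And>k. P (H_class u (sc k))" and "\<And>i. P (H_class u (gc i))"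
    and "\<And>\<sigma>. P (H_class u (gw \<sigma>))" and "\<And>i. P (H_class u (gx i))"
    and "\<And>h h'. h \<in> Hx u \<Longrightarrow> h' \<in> Hx u \<Longrightarrow> P h \<Longrightarrow> P h' \<Longrightarrow> P (h \<oplus>\<^bsub>H_alg u\<^esub> h')"
    and mult: "\<And>h h'. h \<in> Hx u \<Longrightarrow> h' \<in> Hx u \<Longrightarrow> P h \<Longrightarrow> P h' \<Longrightarrow> P (h \<otimes>\<^bsub>H_alg u\<^esub> h')"
  shows "P h"
  using assms(1) unfolding Hx_def
proof (induction rule: generate_ring.induct)
  case one
  have "sc 1 = (1 :: 'n gen free_alg)"
    by (simp add: sc_def)
  then show ?case
    using sc[of 1] by (simp add: H_class_one)
next
  case (a_inv h)
  then have h: "h \<in> Hx u"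
    by (simp add: Hx_def)
  then obtain a where a: "h = H_class u a"
    using Hx_in_carrier carrier_H_alg by blast
  have "sc (- 1) * a = - a"
    by (simp add: sc_def single_uminus)
  then have "\<ominus>\<^bsub>H_alg u\<^esub> h = H_class u (sc (- 1)) \<otimes>\<^bsub>H_alg u\<^esub> h"
    by (simp add: a H_class_uminus flip: H_class_mult)
  then show ?case
    using mult[OF _ h sc a_inv.IH] by simp
qed (use assms in \<open>auto simp: Hx_def\<close>)

lemma act_single_0 [simp]:
  "smul a (Poly_Mapping.single 0 m) = Poly_Mapping.single 0 (scale a m)"
  "c_op i (Poly_Mapping.single 0 m) = Poly_Mapping.single 0 (c i m)"
  "w_op \<sigma> (Poly_Mapping.single 0 m) = Poly_Mapping.single 0 (w \<sigma> m)"
  by (simp_all add: poly_tensor_scale_def c_op_def w_op_def perm_vars_single map_single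
      additive.zero[OF additive_c] additive.zero[OF additive_w])

lemma hact_Hx_constant:
  assumes "h \<in> Hx u"
  shows "\<exists>m'. hact h (Poly_Mapping.single 0 m) = Poly_Mapping.single 0 m'"
  using assms
proof (induction h arbitrary: m rule: Hx_induct)
  case (gx i)
  show ?case by (intro exI[of _ 0]) simp
next
  case (add h h')
  then obtain m1 m2 where "hact h (Poly_Mapping.single 0 m) = Poly_Mapping.single 0 m1"
    "hact h' (Poly_Mapping.single 0 m) = Poly_Mapping.single 0 m2"
    by blast
  then show ?case
    using add.hyps by (intro exI[of _ "m1 + m2"]) (auto simp: hact_add single_add)
next
  case (mult h h')
  then obtain m1 where m1: "hact h' (Poly_Mapping.single 0 m) = Poly_Mapping.single 0 m1"
    by blast
  obtain m2 where "hact h (Poly_Mapping.single 0 m1) = Poly_Mapping.single 0 m2"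
    using mult.IH by blast
  with m1 show ?case
    using mult.hyps by (intro exI[of _ m2]) (auto simp: hact_mult)
qed auto

abbreviation "M_act \<equiv> Hx_action u scale c w"

text \<open>The constants \<open>1 \<otimes> M\<close> form an \<open>Hx\<close>-submodule on which the \<open>x i\<close> vanish; this provides
  the extension of \<open>M\<close> that the choice in \<^const>\<open>Hx_action\<close> needs.\<close>

lemma M_act:
  "left_module_on (H_alg u) (Hx u) M_act"
  "M_act (H_class u (sc a)) m = scale a m"
  "M_act (H_class u (gc i)) m = c i m"
  "M_act (H_class u (gw \<sigma>)) m = w \<sigma> m"
  "M_act (H_class u (gx i)) m = 0"
proof -
  define act where "act h m = Poly_Mapping.lookup (hact h (Poly_Mapping.single 0 m)) 0" for h m
  have act: "hact h (Poly_Mapping.single 0 m) = Poly_Mapping.single 0 (act h m)" if "h \<in> Hx u" for h m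
    using hact_Hx_constant[OF that, of m] by (auto simp: act_def)
  have "left_module_on (H_alg u) (Hx u) act"
    unfolding left_module_on_def
  proof (intro conjI ballI allI)
    fix b b' :: "'n gen free_alg set" and m m'
    assume b: "b \<in> Hx u"
    show "act b (m + m') = act b m + act b m'"
      by (simp add: act_def single_add hact_vec_add lookup_add)
    assume b': "b' \<in> Hx u"
    show "act (b \<oplus>\<^bsub>H_alg u\<^esub> b') m = act b m + act b' m"
      using b b' by (simp add: act_def hact_add lookup_add)
    show "act (b \<otimes>\<^bsub>H_alg u\<^esub> b') m = act b (act b' m)"
      using b b' act[OF b'] by (simp add: act_def hact_mult)
  next
    show "act \<one>\<^bsub>H_alg u\<^esub> m = m" for m
      by (simp add: act_def H_class_one)
  qed
  then have "\<exists>act. left_module_on (H_alg u) (Hx u) act \<and>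
     (\<forall>a m. act (H_class u (sc a)) m = scale a m) \<and>
     (\<forall>i m. act (H_class u (gc i)) m = c i m) \<and>
     (\<forall>\<sigma> m. act (H_class u (gw \<sigma>)) m = w \<sigma> m) \<and>
     (\<forall>i m. act (H_class u (gx i)) m = 0)"
    by (intro exI[of _ act]) (simp add: act_def)
  from someI_ex[OF this]
  show "left_module_on (H_alg u) (Hx u) M_act"
    "M_act (H_class u (sc a)) m = scale a m" "M_act (H_class u (gc i)) m = c i m"
    "M_act (H_class u (gw \<sigma>)) m = w \<sigma> m" "M_act (H_class u (gx i)) m = 0"
    unfolding Hx_action_def[symmetric] by blast+
qed

text \<open>\<open>M_act\<close> is an arbitrary choice, but its values on generators and the module
  laws determine it on \<open>Hx u\<close>. Hence \<open>M\<close>, placed in degree 0, is the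
  chosen module.\<close>

lemma hact_M_act:
  assumes "h \<in> Hx u"
  shows "hact h (Poly_Mapping.single 0 m) = Poly_Mapping.single 0 (M_act h m)"
  using assms
proof (induction h arbitrary: m rule: Hx_induct)
  case (add h h')
  then show ?case
    using M_act(1) by (auto simp: left_module_on_def hact_add single_add)
next
  case (mult h h')
  then show ?case
    using M_act(1) by (auto simp: left_module_on_def hact_mult)
qed (simp_all add: M_act)

sublocale tensor: ring_tensor "H_alg u" "Hx u" M_act
  by (intro ring_tensor.intro ring_tensor_axioms.intro ring_H_alg Hx_carrier)

section \<open>Evaluation on the constants\<close>

text \<open>The map of Frobenius reciprocity, sending \<open>h\<close> tensor \<open>m\<close> to
  \<open>h\<close> applied to the constant \<open>m\<close>, on the free abelian group; hence the
  integer coefficients.\<close>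

definition evalt :: "('n gen free_alg set \<times> 'm \<Rightarrow>\<^sub>0 int) \<Rightarrow> ('n, 'm) ypoly_tensor"
  where "evalt = lin_ext (\<lambda>(h, m) k. smul (of_int k) (hact h (Poly_Mapping.single 0 m)))"

lemma additive_evalt_term: "additive (case x of (h, m) \<Rightarrow> \<lambda>k. smul (of_int k) (hact h (Poly_Mapping.single 0 m)))"
  by (cases x) (simp add: additive_def rep.scale_left_distrib)

lemma additive_evalt: "additive evalt"
  unfolding evalt_def by (rule additive_lin_ext) (rule additive_evalt_term)

lemma evalt_frag_of: "evalt (frag_of (h, m)) = hact h (Poly_Mapping.single 0 m)"
  unfolding evalt_def by (subst lin_ext_single) (rule additive_evalt_term, simp)

text \<open>The balancing relation is respected because \<open>Hx u\<close> acts on the constants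
  through \<open>M_act\<close>.\<close>

lemma evalt_N:
  assumes "t \<in> tensor.N"
  shows "evalt t = 0"
  using assms
proof (induction rule: tensor.N_induct)
  case (balanced h b m)
  then show ?case
    by (simp add: additive.diff[OF additive_evalt] evalt_frag_of hact_mult hact_M_act)
qed (simp_all add: additive.diff[OF additive_evalt] additive.add[OF additive_evalt]
    additive.minus[OF additive_evalt] additive.zero[OF additive_evalt] evalt_frag_of hact_add
    hact_vec_add single_add)

lemma evalt_cong: "tensor.cls t = tensor.cls t' \<Longrightarrow> evalt t = evalt t'"
  using evalt_N[of "t - t'"] by (simp add: tensor.cls_eq_iff additive.diff[OF additive_evalt])

lemma lookup_sum_list_single:
  "Poly_Mapping.lookup (\<Sum>j\<leftarrow>l. Poly_Mapping.single j (1 :: nat)) i = count_list l i"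
  by (induction l) (auto simp: lookup_add lookup_single when_def)

lemma act_yword:
  "rep.act (yword l) (Poly_Mapping.single 0 m) = Poly_Mapping.single (\<Sum>j\<leftarrow>l. Poly_Mapping.single j 1) m"
  by (induction l) (simp_all add: yword_Cons rep.act_mult shift_single add.commute)

lemma y_monomial_yword:
  obtains l where "y_monomial u \<alpha> = H_class u (yword l)"
    and "\<And>m. rep.act (yword l) (Poly_Mapping.single 0 m) = Poly_Mapping.single \<alpha> m"
proof -
  obtain l where l: "\<forall>i. count_list l i = Poly_Mapping.lookup \<alpha> i"
    using ex_list_count by blast
  then have "(\<Sum>j\<leftarrow>l. Poly_Mapping.single j 1) = \<alpha>"
    by (intro poly_mapping_eqI) (simp only: lookup_sum_list_single)
  then show thesis
    using that[of l] l by (metis act_yword y_monomial_eq)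
qed

lemma y_monomial_carrier: "y_monomial u \<alpha> \<in> carrier (H_alg u)"
  by (simp add: y_monomial_def)

lemma evalt_act_y_monomial:
  "evalt (frag_of (H_class u a \<otimes>\<^bsub>H_alg u\<^esub> y_monomial u \<alpha>, m)) = rep.act a (Poly_Mapping.single \<alpha> m)"
proof (rule y_monomial_yword[of \<alpha>])
  fix l
  assume "y_monomial u \<alpha> = H_class u (yword l)"
    and "\<And>m. rep.act (yword l) (Poly_Mapping.single 0 m) = Poly_Mapping.single \<alpha> m"
  then show ?thesis
    by (simp add: evalt_frag_of rep.act_mult flip: H_class_mult)
qed

definition ysum :: "('n, 'm) ypoly_tensor \<Rightarrow> 'n gen free_alg set \<times> 'm \<Rightarrow>\<^sub>0 int"
  where "ysum v = (\<Sum>\<alpha>\<in>Poly_Mapping.keys v. frag_of (y_monomial u \<alpha>, Poly_Mapping.lookup v \<alpha>))"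

lemma ind_embed_eq: "ind_embed u scale c w v = tensor.cls (ysum v)"
  by (simp add: ind_embed_def ysum_def)

lemma evalt_ysum: "evalt (ysum v) = v"
proof -
  have "evalt (frag_of (y_monomial u \<alpha>, m)) = Poly_Mapping.single \<alpha> m" for \<alpha> m
    using evalt_act_y_monomial[of 1 \<alpha> m] y_monomial_carrier[of \<alpha>] by (simp flip: H_class_one)
  then show ?thesis
    by (simp add: ysum_def additive.sum[OF additive_evalt] sum_single_lookup)
qed

lemma inj_ind_embed: "inj (ind_embed u scale c w)"
  by (rule injI) (metis evalt_cong evalt_ysum ind_embed_eq)

text \<open>Cancellation can make the support of a sum smaller than the union of the supports. The
  surplus terms are tensors with 0 and vanish in the quotient, so sums may be compared over a common
  index set.\<close>

lemma cls_ysum_superset: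
  assumes "finite A" "Poly_Mapping.keys v \<subseteq> A"
  shows "tensor.cls (\<Sum>\<alpha>\<in>A. frag_of (y_monomial u \<alpha>, Poly_Mapping.lookup v \<alpha>)) = tensor.cls (ysum v)"
proof -
  let ?t = "\<lambda>\<alpha>. if \<alpha> \<in> Poly_Mapping.keys v then frag_of (y_monomial u \<alpha>, Poly_Mapping.lookup v \<alpha>) else 0"
  have "tensor.cls (\<Sum>\<alpha>\<in>A. frag_of (y_monomial u \<alpha>, Poly_Mapping.lookup v \<alpha>)) = tensor.cls (\<Sum>\<alpha>\<in>A. ?t \<alpha>)"
    by (rule tensor.cls_sum_cong) (auto simp: in_keys_iff tensor.cls_zero y_monomial_carrier)
  also have "(\<Sum>\<alpha>\<in>A. ?t \<alpha>) = ysum v"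
    unfolding ysum_def using assms by (intro sum.mono_neutral_cong_right) auto
  finally show ?thesis .
qed

lemma cls_ysum_add: "tensor.cls (ysum (v + v')) = tensor.cls (ysum v + ysum v')"
proof -
  let ?A = "Poly_Mapping.keys v \<union> Poly_Mapping.keys v'"
  let ?t = "\<lambda>v \<alpha>. frag_of (y_monomial u \<alpha>, Poly_Mapping.lookup v \<alpha>)"
  have "tensor.cls (ysum (v + v')) = tensor.cls (\<Sum>\<alpha>\<in>?A. ?t (v + v') \<alpha>)"
    by (rule cls_ysum_superset[symmetric]) (simp_all add: keys_add)
  also have "\<dots> = tensor.cls (\<Sum>\<alpha>\<in>?A. ?t v \<alpha> + ?t v' \<alpha>)"
    by (rule tensor.cls_sum_cong) (simp add: lookup_add tensor.cls_add_right y_monomial_carrier)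
  also have "\<dots> = tensor.cls (ysum v + ysum v')"
    unfolding sum.distrib by (intro tensor.cls_add_cong cls_ysum_superset) simp_all
  finally show ?thesis .
qed

text \<open>A right factor from \<open>Hx u\<close> crosses the tensor sign and acts on
  \<open>m\<close>; therefore \<open>m\<close> has to vary in the induction.\<close>

lemma cls_yspan:
  assumes "a \<in> yspan u"
  shows "\<exists>v. tensor.cls (frag_of (H_class u a, m)) = tensor.cls (ysum v)"
  using assms
proof (induction arbitrary: m)
  case (yword l)
  let ?\<alpha> = "\<Sum>j\<leftarrow>l. Poly_Mapping.single j 1"
  have "y_monomial u ?\<alpha> = H_class u (yword l)"
    by (rule y_monomial_eq) (simp only: lookup_sum_list_single)
  \<comment> \<open>For \<open>m = 0\<close> the \<open>single\<close> has no keys and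
    \<open>ysum\<close> is an empty sum, so that case needs the vanishing of tensors with 0.\<close>
  then have "tensor.cls (frag_of (H_class u (yword l), m)) = tensor.cls (ysum (Poly_Mapping.single ?\<alpha> m))"
    using tensor.cls_zero[of "H_class u (yword l)"] by (cases "m = 0") (simp_all add: ysum_def)
  then show ?case by blast
next
  case (add a b)
  obtain v v' where v: "tensor.cls (frag_of (H_class u a, m)) = tensor.cls (ysum v)"
    "tensor.cls (frag_of (H_class u b, m)) = tensor.cls (ysum v')"
    using add.IH by blast
  have "tensor.cls (frag_of (H_class u (a + b), m))
    = tensor.cls (frag_of (H_class u a, m) + frag_of (H_class u b, m))"
    by (simp add: H_class_add tensor.cls_add_left)
  also have "\<dots> = tensor.cls (ysum (v + v'))"
    unfolding cls_ysum_add by (intro tensor.cls_add_cong v)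
  finally show ?case by blast
qed (simp_all add: H_class_mult tensor.cls_balanced)

text \<open>The reordering of words only shows that the result is the image of some
  \<open>v'\<close>; it is never computed. Applying \<open>evalt\<close>, a left inverse, to both
  sides then identifies \<open>v'\<close> with \<open>rep.act a v\<close>.\<close>

lemma tensor_left_action_ind_embed:
  "tensor_left_action (H_alg u) (Hx u) M_act (H_class u a) (ind_embed u scale c w v)
    = ind_embed u scale c w (rep.act a v)"
proof -
  let ?t = "\<lambda>\<alpha>. frag_of (H_class u a \<otimes>\<^bsub>H_alg u\<^esub> y_monomial u \<alpha>, Poly_Mapping.lookup v \<alpha>)"
  have "\<exists>v'. tensor.cls (\<Sum>\<alpha>\<in>A. ?t \<alpha>) = tensor.cls (ysum v')" if "finite A" for A
    using that
  proof induction
    case empty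
    show ?case by (intro exI[of _ 0]) (simp add: ysum_def)
  next
    case (insert \<alpha> A)
    obtain l where "y_monomial u \<alpha> = H_class u (yword l)"
      using y_monomial_yword by blast
    then obtain v1 where v1: "tensor.cls (?t \<alpha>) = tensor.cls (ysum v1)"
      using cls_yspan[OF yspan_UNIV, of "a * yword l" "Poly_Mapping.lookup v \<alpha>"] by (auto simp: H_class_mult)
    obtain v2 where v2: "tensor.cls (\<Sum>\<alpha>\<in>A. ?t \<alpha>) = tensor.cls (ysum v2)"
      using insert.IH by blast
    have "tensor.cls (?t \<alpha> + (\<Sum>\<alpha>\<in>A. ?t \<alpha>)) = tensor.cls (ysum (v1 + v2))"
      unfolding cls_ysum_add by (intro tensor.cls_add_cong v1 v2)
    then show ?case using insert.hyps by auto
  qed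
  then obtain v' where v': "tensor.cls (\<Sum>\<alpha>\<in>Poly_Mapping.keys v. ?t \<alpha>) = tensor.cls (ysum v')"
    by (meson finite_keys)
  have "v' = evalt (\<Sum>\<alpha>\<in>Poly_Mapping.keys v. ?t \<alpha>)"
    using evalt_cong[OF v'] by (simp add: evalt_ysum)
  also have "\<dots> = rep.act a v"
    by (simp add: additive.sum[OF additive_evalt] evalt_act_y_monomial sum_single_lookup
        flip: additive.sum[OF rep.additive_act])
  finally have "v' = rep.act a v" .
  then show ?thesis
    using v' by (simp add: ind_embed_eq tensor.tensor_left_action_cls ysum_def frag_extend_sum)
qed

lemma Mx_action_H_class: "Mx_action u scale c w (H_class u a) v = rep.act a v"
  unfolding Mx_action_def tensor_left_action_ind_embed by (rule inv_into_f_f[OF inj_ind_embed UNIV_I])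

end

section \<open>Comparison with the polynomial quotients of the statement\<close>

lemma mult_yvar: "q * yvar i = shift i q"
  by (rule additive_eqI[of "\<lambda>q. q * yvar i"]; (intro additive.intro)?)
    (simp_all add: distrib_right shift_add shift_single yvar_def mult_single)

text \<open>Once multiplication by variables is \<open>shift\<close>, both sides are definite
  descriptions of the same equation.\<close>

lemma poly_quot_eq_ddiff:
  "poly_quot (f - perm_poly (Perm.swap k i) f) (yvar i - yvar k) = ddiff i k f"
  by (simp add: poly_quot_def ddiff_def perm_poly_def perm_vars_def right_diff_distrib mult_yvar)

text \<open>Tensoring with \<open>m\<close> is an additive map on coefficients, so it commutes with
  divided differences; linearity of \<open>refl_coeff\<close> moves it onto
  \<open>m\<close>.\<close>

lemma (in dunkl_module) map_refl_coeff_ddiff_poly_tensor: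
  assumes "k \<noteq> i"
  shows "Poly_Mapping.map (refl_coeff k i) (ddiff i k (poly_tensor scale f m))
    = poly_tensor scale (ddiff i k f) (refl_coeff k i m)"
proof -
  have "additive (\<lambda>a. scale a m)"
    by (simp add: additive_def scale_left_distrib)
  then show ?thesis
    using assms by (simp add: poly_tensor_def ddiff_map map_map_additive additive_refl_coeff refl_coeff_scale)
qed

theorem theorem4p7:
  fixes u :: complex
    and scale :: "complex \<Rightarrow> 'm::ab_group_add \<Rightarrow> 'm"
    and c :: "'n::finite \<Rightarrow> 'm \<Rightarrow> 'm"
    and w :: "'n perm \<Rightarrow> 'm \<Rightarrow> 'm"
    and f :: "'n ypoly"
    and m :: 'm
    and i :: 'n
  assumes "K_module scale c w"
  shows "Mx_action u scale c w (H_class u (gx i)) (poly_tensor scale f m) =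
    poly_tensor_scale scale u
      (\<Sum>k\<in>UNIV - {i}.
        poly_tensor scale
          (poly_quot (f - perm_poly (Perm.swap k i) f) (yvar i - yvar k))
          (w (Perm.swap k i) m + c k (c i (w (Perm.swap k i) m))))"
proof -
  interpret dunkl_module scale c w u
    using assms by (rule dunkl_module.intro)
  show ?thesis
    by (simp add: Mx_action_H_class dunkl_def map_refl_coeff_ddiff_poly_tensor poly_quot_eq_ddiff flip: refl_coeff_def)
qed

end
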